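(* Let $(R,\mathfrak{m},k)$ be a $d$-dimensional $F$-finite Noetherian local ring of prime characteristic $p>0$, and let $\alpha(R)=\log_p[k:k^p]$. For $e\in\mathbb{N}$ let $a_e$ be the $e$-th Frobenius splitting number of $R$. Then the limit $$s(R)=\lim_{e\to\infty}\frac{a_e}{p^{e(d+\alpha(R))}}$$ exists (it is called the $F$-signature of $R$). More generally, if $P$ is the splitting prime of $R$, then the limit $$r_F(R)=\lim_{e\to\infty}\frac{a_e}{p^{e(\dim(R/P)+\alpha(R))}}$$ exists (it is called the $F$-splitting ratio of $R$).
   Context: All rings are commutative with unit and Noetherian; $\mathbb{N}$ denotes the positive integers. For a ring $R$ of prime characteristic $p$ and $e\in\mathbb{N}$, $F^e_*R$ denotes $R$ viewed as an $R$-module by restriction of scalars along the $e$-th iterated Frobenius $r\mapsto r^{p^e}$; the element of $F^e_*R$ corresponding to $r\in R$ is written $F^e_*r$, so $s\cdot F^e_*r=F^e_*(s^{p^e}r)$. $R$ is $F$-finite if $F_*R$ is a finitely generated $R$-module (then every $F^e_*R$ is finitely generated). The $e$-th Frobenius splitting number $a_e$ is the largest rank of a free $R$-module appearing in a direct sum decomposition of $F^e_*R$; that is, $F^e_*R\cong R^{\oplus a_e}\oplus M_e$ where $M_e$ has no nonzero free direct summand. For $e\in\mathbb{N}$ put $$I_e=\{r\in R : \phi(F^e_*r)\in\mathfrak{m}\text{ for all }\phi\in\operatorname{Hom}_R(F^e_*R,R)\},$$ which is an ideal of $R$. The splitting prime of $R$ is $P=\bigcap_{e\in\mathbb{N}}I_e$;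 it is either a prime ideal or all of $R$. The case $P=R$ occurs exactly when $R$ is not $F$-pure (i.e. $F:R\to F_*R$ does not split as a map of $R$-modules); in that case $a_e=0$ for all $e\in\mathbb{N}$ and the second limit is understood to be $0$, whatever convention is used for the dimension of the zero ring. *)

theory Defs
  imports Complex_Main "HOL-Library.Extended_Nat" "HOL-Algebra.Algebra"
begin

locale noetherian_local_ring = cring R + noetherian_ring R + maximalideal \<mm> R
  for R :: "('a, 'b) ring_scheme" (structure) and \<mm> :: "'a set" +
  assumes maximal_unique: "maximalideal J R \<Longrightarrow> J = \<mm>"

definition has_characteristic :: "('a, 'b) ring_scheme \<Rightarrow> nat \<Rightarrow> bool" where
  "has_characteristic R n \<longleftrightarrow> (\<forall>k::nat. add_pow R k \<one>\<^bsub>R\<^esub> = \<zero>\<^bsub>R\<^esub> \<longleftrightarrow> n dvd k)"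

text \<open>The supremum is taken over all \<open>n\<close> such that there is a chain
  \<open>f 0 \<subset> \<dots> \<subset> f n\<close> of prime ideals. In \<^typ>\<open>enat\<close> the supremum of the empty set is \<open>0\<close>,
  so the zero ring gets dimension \<open>0\<close>.\<close>

definition krull_dim :: "('a, 'b) ring_scheme \<Rightarrow> enat" where
  "krull_dim R = (SUP n \<in> {n. \<exists>f :: nat \<Rightarrow> 'a set.
      (\<forall>i\<le>n. primeideal (f i) R) \<and> (\<forall>i<n. f i \<subset> f (Suc i))}. enat n)"

definition module_hom ::
  "('a, 'r) ring_scheme \<Rightarrow> ('a, 'b, 'm) module_scheme \<Rightarrow> ('a, 'c, 'n) module_scheme \<Rightarrow> ('b \<Rightarrow> 'c) set"
  where "module_hom R M N = {\<phi> \<in> carrier M \<rightarrow> carrier N.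
      (\<forall>x \<in> carrier M. \<forall>y \<in> carrier M. \<phi> (x \<oplus>\<^bsub>M\<^esub> y) = \<phi> x \<oplus>\<^bsub>N\<^esub> \<phi> y) \<and>
      (\<forall>a \<in> carrier R. \<forall>x \<in> carrier M. \<phi> (a \<odot>\<^bsub>M\<^esub> x) = a \<odot>\<^bsub>N\<^esub> \<phi> x)}"

definition module_iso ::
  "('a, 'r) ring_scheme \<Rightarrow> ('a, 'b, 'm) module_scheme \<Rightarrow> ('a, 'c, 'n) module_scheme \<Rightarrow> bool"
  where "module_iso R M N \<longleftrightarrow> (\<exists>\<phi> \<in> module_hom R M N. bij_betw \<phi> (carrier M) (carrier N))"

definition finitely_generated_module ::
  "('a, 'r) ring_scheme \<Rightarrow> ('a, 'b, 'm) module_scheme \<Rightarrow> bool" where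
  "finitely_generated_module R M \<longleftrightarrow> (\<exists>A. finite A \<and> A \<subseteq> carrier M \<and>
      (\<forall>N. submodule N R M \<and> A \<subseteq> N \<longrightarrow> N = carrier M))"

text \<open>The type \<^typ>\<open>('a, 'b) module\<close> extends the ring record, so a module also carries
  components \<^const>\<open>monoid.mult\<close> and \<^const>\<open>monoid.one\<close>; they play no role for modules.\<close>

definition self_module :: "('a, 'r) ring_scheme \<Rightarrow> ('a, 'a) module" where
  "self_module R = \<lparr>carrier = carrier R, monoid.mult = monoid.mult R, one = \<one>\<^bsub>R\<^esub>,
      ring.zero = \<zero>\<^bsub>R\<^esub>, ring.add = ring.add R, smult = monoid.mult R\<rparr>"

definition free_module :: "('a, 'r) ring_scheme \<Rightarrow> nat \<Rightarrow> ('a, nat \<Rightarrow> 'a) module" where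
  "free_module R n = \<lparr>carrier = {..<n} \<rightarrow>\<^sub>E carrier R,
      monoid.mult = (\<lambda>x y. \<lambda>i\<in>{..<n}. x i \<otimes>\<^bsub>R\<^esub> y i), one = (\<lambda>i\<in>{..<n}. \<one>\<^bsub>R\<^esub>),
      ring.zero = (\<lambda>i\<in>{..<n}. \<zero>\<^bsub>R\<^esub>), ring.add = (\<lambda>x y. \<lambda>i\<in>{..<n}. x i \<oplus>\<^bsub>R\<^esub> y i),
      smult = (\<lambda>a x. \<lambda>i\<in>{..<n}. a \<otimes>\<^bsub>R\<^esub> x i)\<rparr>"

text \<open>\<open>F\<^sup>e\<^sub>*R\<close>: the element written \<open>F\<^sup>e\<^sub>*r\<close> is represented by \<open>r\<close> itself.\<close>

definition frobenius_pushforward ::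
  "nat \<Rightarrow> ('a, 'r) ring_scheme \<Rightarrow> nat \<Rightarrow> ('a, 'a) module" where
  "frobenius_pushforward p R e = \<lparr>carrier = carrier R, monoid.mult = monoid.mult R, one = \<one>\<^bsub>R\<^esub>,
      ring.zero = \<zero>\<^bsub>R\<^esub>, ring.add = ring.add R, smult = (\<lambda>s r. (s [^]\<^bsub>R\<^esub> (p ^ e)) \<otimes>\<^bsub>R\<^esub> r)\<rparr>"

definition F_finite :: "nat \<Rightarrow> ('a, 'r) ring_scheme \<Rightarrow> bool" where
  "F_finite p R \<longleftrightarrow> finitely_generated_module R (frobenius_pushforward p R 1)"

text \<open>\<open>M\<close> is the internal direct sum of submodules \<open>N\<close> and \<open>L\<close> with \<open>N\<close> free of rank \<open>n\<close>.\<close>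

definition has_free_summand ::
  "('a, 'r) ring_scheme \<Rightarrow> ('a, 'b, 'm) module_scheme \<Rightarrow> nat \<Rightarrow> bool" where
  "has_free_summand R M n \<longleftrightarrow> (\<exists>N L. submodule N R M \<and> submodule L R M \<and>
      N \<inter> L = {\<zero>\<^bsub>M\<^esub>} \<and> N <+>\<^bsub>M\<^esub> L = carrier M \<and>
      module_iso R (free_module R n) (M\<lparr>carrier := N\<rparr>))"

definition splitting_number :: "nat \<Rightarrow> ('a, 'r) ring_scheme \<Rightarrow> nat \<Rightarrow> nat" where
  "splitting_number p R e = Max {n. has_free_summand R (frobenius_pushforward p R e) n}"

definition splitting_ideal :: "nat \<Rightarrow> ('a, 'r) ring_scheme \<Rightarrow> 'a set \<Rightarrow> nat \<Rightarrow> 'a set" where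
  "splitting_ideal p R \<mm> e = {r \<in> carrier R.
      \<forall>\<phi> \<in> module_hom R (frobenius_pushforward p R e) (self_module R). \<phi> r \<in> \<mm>}"

definition splitting_prime :: "nat \<Rightarrow> ('a, 'r) ring_scheme \<Rightarrow> 'a set \<Rightarrow> 'a set" where
  "splitting_prime p R \<mm> = (\<Inter>e\<in>{1..}. splitting_ideal p R \<mm> e)"

text \<open>\<open>log\<^sub>p [k : k\<^sup>p]\<close> for the residue field \<open>k = R/\<mm>\<close>.\<close>

definition residue_alpha :: "nat \<Rightarrow> ('a, 'r) ring_scheme \<Rightarrow> 'a set \<Rightarrow> real" where
  "residue_alpha p R \<mm> = (let k = R Quot \<mm> in
      log (real p) (real (ring.dim k ((\<lambda>x. x [^]\<^bsub>k\<^esub> p) ` carrier k) (carrier k))))"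

end

theory Submission
  imports Defs
begin

text \<open>Write \<open>I\<^sub>e\<close> for the splitting ideals, \<open>P\<close> for the splitting prime, \<open>D = R/P\<close>,
  \<open>\<delta> = dim D\<close>, \<open>\<kappa> = [k : k\<^sup>p]\<close> and \<open>L = \<kappa> p\<^sup>\<delta>\<close>. Every element outside \<open>I\<^sub>e\<close> splits
  off a free summand, so \<open>a\<^sub>e\<close> is the minimal number of generators of \<open>F\<^sup>e\<^sub>*(R/I\<^sub>e)\<close>.
  By induction on the dimension (cutting a prime quotient by \<open>x\<close> multiplies the number of
  generators by at most \<open>p\<^sup>e\<close>, and other quotients are filtered by prime ones),
  \<open>F\<^sup>e\<^sub>*(R/J)\<close> has at most \<open>C (\<kappa> p\<^bsup>dim R/J\<^esup>)\<^sup>e\<close> generators.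
  Let \<open>n\<close> be the rank of \<open>F\<^sub>*D\<close>. As \<open>F\<^sup>e\<^sub>*D\<close> has rank at least \<open>n\<^sup>e\<close>, the bound gives
  \<open>n \<le> L\<close>. A map \<open>D\<^sup>n \<rightarrow> F\<^sub>*D\<close> whose cokernel is torsion, together with the inclusion
  \<open>I\<^sub>e\<^bsup>[p]\<^esup> \<subseteq> I\<^bsub>e+1\<^esub>\<close>, yields \<open>a\<^bsub>e+1\<^esub> \<le> n a\<^sub>e + C (L/p)\<^sup>e\<close>. Hence \<open>a\<^sub>e/L\<^sup>e\<close> is nonincreasing up to
  a summable error and converges.\<close>

section \<open>Frobenius powers and generation of \<open>F\<^sup>e\<^sub>*R\<close>\<close>

text \<open>Passing from R to D is what makes a rank available: R need not be reduced, whereas D is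
  a domain as soon as P is proper, and since P lies in every I_e with e \<ge> 1, each such
  F^e_*(R/I_e) is a quotient of F^e_*D. Generators can be counted by linear algebra because the
  maximal ideal kills F^e_*(R/I_e), which is therefore a vector space over k, with a dual basis
  coming from a maximal free summand. The factor 1/p in the error term comes from dimension: a
  torsion cokernel is killed by some c outside P, hence is a module over R/(P + cR), whose dimension
  is smaller than \<delta>. The recursion is one-sided, which suffices for a sequence bounded below
  by 0; the only fact about n that enters is n \<le> L. The F-signature follows from the splitting
  ratio: \<delta> \<le> d, and the two sequences differ by the factor p^((\<delta> - d) e), itself a
  convergent sequence.\<close>

lemma (in cring) binomial_expansion:
  assumes x: "x \<in> carrier R" and y: "y \<in> carrier R"
  shows "(x \<oplus> y) [^] n = (\<Oplus>k\<in>{..n}. add_pow R (n choose k) (x [^] k \<otimes> y [^] (n - k)))"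
proof (induction n)
  case 0
  then show ?case using x y by simp
next
  case (Suc n)
  let ?f = "\<lambda>k. add_pow R (n choose k) (x [^] k \<otimes> y [^] (n - k))"
  \<comment> \<open>The index 0 is separated because \<open>k - 1\<close> truncates there and would
    contribute a spurious summand.\<close>
  let ?g = "\<lambda>k. if k = 0 then \<zero> else add_pow R (n choose (k - 1)) (x [^] k \<otimes> y [^] (Suc n - k))"
  let ?h = "\<lambda>k. add_pow R (n choose k) (x [^] k \<otimes> y [^] (Suc n - k))"
  have f: "?f k \<in> carrier R" and g: "?g k \<in> carrier R" and h: "?h k \<in> carrier R" for k
    using x y by auto
  have "(\<Oplus>k\<in>{..n}. ?f k) \<otimes> x = (\<Oplus>k\<in>{..n}. ?f k \<otimes> x)"
    using finsum_ldistr[of "{..n}" x ?f] f x by auto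
  also have "\<dots> = (\<Oplus>k\<in>{..n}. ?g (Suc k))"
    using x y by (intro finsum_cong') (auto simp: add_pow_ldistr m_ac add_pow_rdistr)
  also have "\<dots> = (\<Oplus>k\<in>{..Suc n}. ?g k)"
  proof -
    have "(\<Oplus>k\<in>{..Suc n}. ?g k) = (\<Oplus>k\<in>{..n}. ?g (Suc k)) \<oplus> ?g 0"
      by (rule finsum_Suc2) (use g in blast)
    moreover have "(\<Oplus>k\<in>{..n}. ?g (Suc k)) \<in> carrier R"
      by (rule finsum_closed) (use g in blast)
    ultimately show ?thesis by simp
  qed
  finally have 1: "(\<Oplus>k\<in>{..n}. ?f k) \<otimes> x = (\<Oplus>k\<in>{..Suc n}. ?g k)" .
  have "(\<Oplus>k\<in>{..n}. ?f k) \<otimes> y = (\<Oplus>k\<in>{..n}. ?f k \<otimes> y)"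
    using finsum_ldistr[of "{..n}" y ?f] f y by auto
  also have "\<dots> = (\<Oplus>k\<in>{..n}. ?h k)"
    using x y by (intro finsum_cong') (auto simp: add_pow_ldistr m_assoc Suc_diff_le)
  also have "\<dots> = (\<Oplus>k\<in>{..Suc n}. ?h k)"
  proof -
    have "(\<Oplus>k\<in>{..Suc n}. ?h k) = ?h (Suc n) \<oplus> (\<Oplus>k\<in>{..n}. ?h k)"
      by (rule finsum_Suc) (use h in blast)
    moreover have "(\<Oplus>k\<in>{..n}. ?h k) \<in> carrier R"
      by (rule finsum_closed) (use h in blast)
    ultimately show ?thesis using x y by (simp add: binomial_eq_0)
  qed
  finally have 2: "(\<Oplus>k\<in>{..n}. ?f k) \<otimes> y = (\<Oplus>k\<in>{..Suc n}. ?h k)" .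
  have "(x \<oplus> y) [^] Suc n = (\<Oplus>k\<in>{..n}. ?f k) \<otimes> x \<oplus> (\<Oplus>k\<in>{..n}. ?f k) \<otimes> y"
    using Suc x y f by (simp add: r_distr)
  also have "\<dots> = (\<Oplus>k\<in>{..Suc n}. ?g k \<oplus> ?h k)"
    unfolding 1 2 using g h by (subst finsum_addf) auto
  also have "\<dots> = (\<Oplus>k\<in>{..Suc n}. add_pow R (Suc n choose k) (x [^] k \<otimes> y [^] (Suc n - k)))"
  proof (rule finsum_cong')
    fix k assume "k \<in> {..Suc n}"
    show "?g k \<oplus> ?h k = add_pow R (Suc n choose k) (x [^] k \<otimes> y [^] (Suc n - k))"
    proof (cases k)
      case 0
      then show ?thesis using x y by simp
    next
      case (Suc j)
      then show ?thesis using x y by (simp add: add.nat_pow_mult)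
    qed
  qed (use x y in auto)
  finally show ?case .
qed

locale char_p_ring = cring R for R (structure) +
  fixes p :: nat
  assumes prime_p: "Factorial_Ring.prime p" and char_p: "has_characteristic R p"
begin

lemma p_gt_1: "p > 1" using prime_p by (rule prime_gt_1_nat)

lemma add_pow_eq_zero:
  assumes "p dvd n" "x \<in> carrier R"
  shows "add_pow R n x = \<zero>"
proof -
  have "add_pow R n \<one> = \<zero>" using char_p assms(1) by (simp add: has_characteristic_def)
  then show ?thesis using add_pow_ldistr[of \<one> x n] assms(2) by simp
qed

lemma add_pow_p:
  assumes x: "x \<in> carrier R" and y: "y \<in> carrier R"
  shows "(x \<oplus> y) [^] p = x [^] p \<oplus> y [^] p"
proof -
  let ?f = "\<lambda>k. add_pow R (p choose k) (x [^] k \<otimes> y [^] (p - k))"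
  obtain m where m: "p = Suc m" using p_gt_1 by (cases p) auto
  have "(x \<oplus> y) [^] p = (\<Oplus>k\<in>{..p}. ?f k)" using x y by (rule binomial_expansion)
  also have "\<dots> = ?f p \<oplus> (\<Oplus>k\<in>{..m}. ?f k)"
    unfolding m by (rule finsum_Suc) (use x y in auto)
  also have "(\<Oplus>k\<in>{..m}. ?f k) = (\<Oplus>k\<in>{..m}. if k = 0 then y [^] p else \<zero>)"
  proof (rule finsum_cong')
    \<comment> \<open>For \<open>0 < k < p\<close> the prime \<open>p\<close> divides
      \<open>p choose k\<close>; besides the top term only \<open>k = 0\<close> survives.\<close>
    fix k assume "k \<in> {..m}"
    then show "?f k = (if k = 0 then y [^] p else \<zero>)"
      using x y m prime_p by (auto intro!: add_pow_eq_zero dvd_choose_prime)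
  qed (use y in auto)
  also have "\<dots> = y [^] p"
    using add.finprod_singleton[of 0 "{..m}" "\<lambda>_. y [^] p"] y by (simp add: eq_commute)
  finally show ?thesis using x y by simp
qed

definition frob :: "nat \<Rightarrow> 'a \<Rightarrow> 'a" where "frob e x = x [^] (p ^ e)"

lemma frob_closed [simp, intro]: "x \<in> carrier R \<Longrightarrow> frob e x \<in> carrier R"
  by (simp add: frob_def)

lemma frob_0 [simp]: "x \<in> carrier R \<Longrightarrow> frob 0 x = x"
  by (simp add: frob_def)

lemma frob_1: "frob 1 x = x [^] p" by (simp add: frob_def)

lemma frob_frob [simp]: "x \<in> carrier R \<Longrightarrow> frob d (frob e x) = frob (d + e) x"
  by (simp add: frob_def nat_pow_pow power_add mult.commute)

lemma frob_add:
  assumes "x \<in> carrier R" "y \<in> carrier R"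
  shows "frob e (x \<oplus> y) = frob e x \<oplus> frob e y"
proof (induction e)
  case (Suc e)
  have "frob 1 (frob e (x \<oplus> y)) = frob 1 (frob e x) \<oplus> frob 1 (frob e y)"
    unfolding Suc frob_1 using assms by (simp add: add_pow_p)
  then show ?case using assms by simp
qed (use assms in simp)

lemma frob_mult:
  "x \<in> carrier R \<Longrightarrow> y \<in> carrier R \<Longrightarrow> frob e (x \<otimes> y) = frob e x \<otimes> frob e y"
  by (simp add: frob_def nat_pow_distrib)

lemma frob_one [simp]: "frob e \<one> = \<one>" by (simp add: frob_def)

lemma frob_zero [simp]: "frob e \<zero> = \<zero>"
  using p_gt_1 by (simp add: frob_def nat_pow_zero)

lemma frob_minus:
  assumes "x \<in> carrier R"
  shows "frob e (\<ominus> x) = \<ominus> frob e x"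
  using frob_add[of x "\<ominus> x" e] assms
  by (metis a_inv_closed frob_closed frob_zero minus_equality r_neg a_comm)

lemma frob_mem_ideal:
  assumes "ideal I R" "x \<in> I"
  shows "frob e x \<in> I"
proof -
  interpret I: ideal I R by fact
  obtain m where "p ^ e = Suc m" using p_gt_1 by (cases "p ^ e") auto
  then show ?thesis using assms(2) I.Icarr by (simp add: frob_def I.I_l_closed)
qed

text \<open>An additive subgroup of \<open>R\<close> that is a submodule of \<open>F\<^sup>e\<^sub>*R\<close>.\<close>

definition fsub :: "nat \<Rightarrow> 'a set \<Rightarrow> bool" where
  "fsub e B \<longleftrightarrow> B \<subseteq> carrier R \<and> \<zero> \<in> B \<and> (\<forall>x\<in>B. \<forall>y\<in>B. x \<oplus> y \<in> B)
     \<and> (\<forall>s\<in>carrier R. \<forall>x\<in>B. frob e s \<otimes> x \<in> B)"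

lemma fsub_carrier: "fsub e B \<Longrightarrow> x \<in> B \<Longrightarrow> x \<in> carrier R"
  and fsub_zero: "fsub e B \<Longrightarrow> \<zero> \<in> B"
  and fsub_add: "fsub e B \<Longrightarrow> x \<in> B \<Longrightarrow> y \<in> B \<Longrightarrow> x \<oplus> y \<in> B"
  and fsub_smult: "fsub e B \<Longrightarrow> s \<in> carrier R \<Longrightarrow> x \<in> B \<Longrightarrow> frob e s \<otimes> x \<in> B"
  by (auto simp: fsub_def)

lemma fsub_minus:
  assumes "fsub e B" "x \<in> B"
  shows "\<ominus> x \<in> B"
  using fsub_smult[OF assms(1), of "\<ominus> \<one>" x] fsub_carrier[OF assms] assms
  by (simp add: frob_minus l_minus)

lemma fsub_diff: "fsub e B \<Longrightarrow> x \<in> B \<Longrightarrow> y \<in> B \<Longrightarrow> x \<ominus> y \<in> B"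
  by (simp add: a_minus_def fsub_add fsub_minus)

lemma fsub_zero_set [simp]: "fsub e {\<zero>}" by (auto simp: fsub_def)

lemma fsub_ideal: "ideal I R \<Longrightarrow> fsub e I"
  unfolding fsub_def
  by (auto simp: ideal.Icarr additive_subgroup.zero_closed additive_subgroup.a_closed
      ideal.axioms(1) ideal.I_l_closed)

text \<open>For \<open>fsub e B\<close>, this is the preimage in \<open>F\<^sup>e\<^sub>*R\<close> of the submodule of \<open>F\<^sup>e\<^sub>*R / B\<close> generated
  by \<open>S\<close>. Only quotients of the modules \<open>F\<^sup>e\<^sub>*R\<close> occur in the argument, so no abstract modules are needed.\<close>

inductive_set fspan :: "nat \<Rightarrow> 'a set \<Rightarrow> 'a set \<Rightarrow> 'a set" for e S B where
  base: "b \<in> B \<Longrightarrow> b \<in> fspan e S B"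
| gen: "s \<in> carrier R \<Longrightarrow> x \<in> S \<Longrightarrow> frob e s \<otimes> x \<in> fspan e S B"
| add: "a \<in> fspan e S B \<Longrightarrow> b \<in> fspan e S B \<Longrightarrow> a \<oplus> b \<in> fspan e S B"

lemma fspan_minimal:
  assumes "fsub e D" "B \<subseteq> D" "S \<subseteq> D"
  shows "fspan e S B \<subseteq> D"
proof
  fix a assume "a \<in> fspan e S B"
  then show "a \<in> D" by induction (use assms fsub_add fsub_smult in auto)
qed

lemma fsub_fspan:
  assumes B: "fsub e B" and S: "S \<subseteq> carrier R"
  shows "fsub e (fspan e S B)"
proof -
  have c: "fspan e S B \<subseteq> carrier R"
  proof
    fix a assume "a \<in> fspan e S B"
    then show "a \<in> carrier R" by induction (use B S fsub_carrier in auto)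
  qed
  have "frob e s \<otimes> a \<in> fspan e S B" if s: "s \<in> carrier R" and a: "a \<in> fspan e S B" for s a
    using a
  proof induction
    case (base b)
    then show ?case using B s by (auto intro: fspan.base fsub_smult)
  next
    case (gen t x)
    then have "frob e s \<otimes> (frob e t \<otimes> x) = frob e (s \<otimes> t) \<otimes> x"
      using s S by (auto simp: frob_mult m_assoc)
    then show ?case using gen s by (auto intro: fspan.gen)
  next
    case (add a b)
    then have "frob e s \<otimes> (a \<oplus> b) = frob e s \<otimes> a \<oplus> frob e s \<otimes> b"
      using s c by (auto intro: r_distr)
    then show ?case using add by (auto intro: fspan.add)
  qed
  then show ?thesis using c B by (auto simp: fsub_def intro: fspan.base fspan.add)
qed

lemma fspan_mem: "x \<in> S \<Longrightarrow> x \<in> carrier R \<Longrightarrow> x \<in> fspan e S B"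
  using fspan.gen[of \<one> x S e B] by simp

lemma fspan_mono: "S \<subseteq> Y \<Longrightarrow> B \<subseteq> D \<Longrightarrow> fspan e S B \<subseteq> fspan e Y D"
proof
  fix a assume "S \<subseteq> Y" "B \<subseteq> D" "a \<in> fspan e S B"
  from this(3) show "a \<in> fspan e Y D"
    by induction (use \<open>S \<subseteq> Y\<close> \<open>B \<subseteq> D\<close> in \<open>auto intro: fspan.intros\<close>)
qed

lemma fspan_decomp:
  assumes B: "fsub e B" and S: "S \<subseteq> carrier R" and a: "a \<in> fspan e S B"
  obtains w b where "w \<in> fspan e S {\<zero>}" "b \<in> B" "a = w \<oplus> b"
proof -
  have c: "w \<in> carrier R" if "w \<in> fspan e S {\<zero>}" for w
    using that fsub_fspan[OF fsub_zero_set S] fsub_carrier by blast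
  have "\<exists>w\<in>fspan e S {\<zero>}. \<exists>b\<in>B. a = w \<oplus> b"
    using a
  proof induction
    case (base b)
    then have "b = \<zero> \<oplus> b" using B by (simp add: fsub_carrier)
    then show ?case using base by (blast intro: fspan.base)
  next
    case (gen s x)
    then have "frob e s \<otimes> x = frob e s \<otimes> x \<oplus> \<zero>" using S by auto
    then show ?case using gen fsub_zero[OF B] by (blast intro: fspan.gen)
  next
    case (add a a')
    then obtain w b w' b' where "w \<in> fspan e S {\<zero>}" "b \<in> B" "a = w \<oplus> b"
      "w' \<in> fspan e S {\<zero>}" "b' \<in> B" "a' = w' \<oplus> b'" by blast
    then have "w \<oplus> w' \<in> fspan e S {\<zero>}" "b \<oplus> b' \<in> B" "a \<oplus> a' = (w \<oplus> w') \<oplus> (b \<oplus> b')"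
      using B c by (auto simp: fspan.add fsub_add fsub_carrier a_ac)
    then show ?case by blast
  qed
  then show thesis using that by blast
qed

text \<open>Additivity of \<open>frob e\<close> lets all coefficients of \<open>x\<close> be
  collected into one. The resulting relation is what the exchange property and Nakayama's lemma
  solve for a generator.\<close>

lemma fspan_insert_decomp:
  assumes B: "fsub e B" and S: "S \<subseteq> carrier R" and x: "x \<in> carrier R"
    and a: "a \<in> fspan e (insert x S) B"
  obtains s w where "s \<in> carrier R" "w \<in> fspan e S B" "a = frob e s \<otimes> x \<oplus> w"
proof -
  have c: "w \<in> carrier R" if "w \<in> fspan e S B" for w
    using that fsub_fspan[OF B S] fsub_carrier by blast
  have "\<exists>s\<in>carrier R. \<exists>w\<in>fspan e S B. a = frob e s \<otimes> x \<oplus> w"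
    using a
  proof induction
    case (base b)
    then have "b = frob e \<zero> \<otimes> x \<oplus> b" using B x by (simp add: fsub_carrier)
    then show ?case using base by (blast intro: fspan.base)
  next
    case (gen s y)
    show ?case
    proof (cases "y = x")
      case True
      then have "frob e s \<otimes> y = frob e s \<otimes> x \<oplus> \<zero>" using gen x by simp
      then show ?thesis using gen fsub_zero[OF B] by (blast intro: fspan.base)
    next
      case False
      then have y: "y \<in> S" using gen by auto
      then have "y \<in> carrier R" using S by auto
      then have "frob e s \<otimes> y = frob e \<zero> \<otimes> x \<oplus> frob e s \<otimes> y" using gen x by simp
      then show ?thesis using gen y by (blast intro: fspan.gen)
    qed
  next
    case (add a a')
    then obtain s w s' w' where *: "s \<in> carrier R" "w \<in> fspan e S B" "a = frob e s \<otimes> x \<oplus> w"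
      "s' \<in> carrier R" "w' \<in> fspan e S B" "a' = frob e s' \<otimes> x \<oplus> w'" by blast
    then have "a \<oplus> a' = frob e (s \<oplus> s') \<otimes> x \<oplus> (w \<oplus> w')"
      using x c[of w] c[of w'] by (simp add: frob_add l_distr a_ac)
    then show ?case using * by (blast intro: fspan.add)
  qed
  then show thesis using that by blast
qed

section \<open>Generator numbers of quotients of F^e_*R\<close>

definition fgen :: "nat \<Rightarrow> 'a set \<Rightarrow> nat \<Rightarrow> bool" where
  "fgen e B n \<longleftrightarrow> (\<exists>S. finite S \<and> S \<subseteq> carrier R \<and> card S \<le> n \<and> fspan e S B = carrier R)"

lemma fgen_carrier [simp]: "fgen e (carrier R) n"
  unfolding fgen_def
  using fspan_minimal[of e "carrier R" "carrier R" "{}"] fsub_ideal[OF oneideal]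
  by (auto intro!: exI[of _ "{}"] fspan.base)

lemma fgenI:
  assumes "fsub e B" "finite S" "S \<subseteq> carrier R" "card S \<le> n" "carrier R \<subseteq> fspan e S B"
  shows "fgen e B n"
  using assms fsub_fspan[OF assms(1,3)] unfolding fgen_def fsub_def by blast

text \<open>Generators of the quotient by \<open>A\<close>, together with elements generating
  \<open>A\<close> modulo \<open>B\<close>, generate the quotient by \<open>B\<close>.\<close>

lemma fgen_trans:
  assumes A: "fsub e A" and B: "fsub e B" and "fgen e A n"
    and Z: "finite Z" "Z \<subseteq> carrier R" "A \<subseteq> fspan e Z B"
  shows "fgen e B (n + card Z)"
proof -
  obtain S where S: "finite S" "S \<subseteq> carrier R" "card S \<le> n" "fspan e S A = carrier R"
    using assms(3) unfolding fgen_def by blast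
  have "fspan e S A \<subseteq> fspan e (S \<union> Z) B"
  proof (rule fspan_minimal)
    show "fsub e (fspan e (S \<union> Z) B)" using B S Z by (intro fsub_fspan) auto
    show "A \<subseteq> fspan e (S \<union> Z) B" using Z fspan_mono[of Z "S \<union> Z" B B e] by auto
    show "S \<subseteq> fspan e (S \<union> Z) B" using S by (auto intro: fspan_mem)
  qed
  moreover have "card (S \<union> Z) \<le> n + card Z"
    using card_Un_le[of S Z] S by linarith
  ultimately show ?thesis using S Z B by (intro fgenI[of e B "S \<union> Z"]) auto
qed

text \<open>This is F^(d+e)_* = F^d_* F^e_* on generators: in \<open>frob d s \<otimes> z\<close>
  the coefficient \<open>s\<close> is expanded over \<open>Y\<close> modulo \<open>J\<close>, and
  the remainder is harmless if \<open>J\<close> sends every \<open>z\<close> into \<open>B\<close>.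
  Keeping \<open>J\<close>, \<open>B\<close> and \<open>D\<close> separate allows \<open>J\<close>
  and \<open>B\<close> to be different ideals in the recursion for splitting numbers.\<close>

lemma fspan_pushforward:
  assumes B: "fsub (d + e) B" and Y: "Y \<subseteq> carrier R" "fspan e Y J = carrier R" and J: "fsub e J"
    and Z: "Z \<subseteq> carrier R" and D: "D \<subseteq> B"
    and JB: "\<And>w z. w \<in> J \<Longrightarrow> z \<in> Z \<Longrightarrow> frob d w \<otimes> z \<in> B"
  shows "fspan d Z D \<subseteq> fspan (d + e) ((\<lambda>(y, z). frob d y \<otimes> z) ` (Y \<times> Z)) B"
    (is "_ \<subseteq> fspan _ ?W B")
proof
  have W: "?W \<subseteq> carrier R" using Y Z by auto
  have mem: "frob d s \<otimes> z \<in> fspan (d + e) ?W B" if z: "z \<in> Z" and s: "s \<in> fspan e Y J" for s z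
    using s
  proof induction
    case (base b)
    then show ?case using JB z by (auto intro: fspan.base)
  next
    case (gen t y)
    then have "frob d (frob e t \<otimes> y) \<otimes> z = frob (d + e) t \<otimes> (frob d y \<otimes> z)"
      using Y Z z by (auto simp: frob_mult m_assoc subset_eq)
    then show ?case using gen z by (auto intro!: fspan.gen)
  next
    case (add a b)
    then have "frob d (a \<oplus> b) \<otimes> z = frob d a \<otimes> z \<oplus> frob d b \<otimes> z"
      using Y J Z z fsub_fspan[OF J Y(1)] by (auto simp: frob_add l_distr subset_eq fsub_carrier)
    then show ?case using add by (auto intro: fspan.add)
  qed
  fix a assume "a \<in> fspan d Z D"
  then show "a \<in> fspan (d + e) ?W B"
  proof induction
    case (base b)
    then show ?case using D by (auto intro: fspan.base)
  next
    case (gen s z)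
    then show ?case using mem Y by auto
  qed (rule fspan.add)
qed

lemma card_products_le:
  assumes "finite Y" "finite Z" "card Y \<le> n" "card Z \<le> m"
  shows "card (f ` (Y \<times> Z)) \<le> n * m"
proof -
  have "card (f ` (Y \<times> Z)) \<le> card (Y \<times> Z)" using assms by (intro card_image_le) auto
  also have "\<dots> \<le> n * m" using assms by (simp add: card_cartesian_product mult_le_mono)
  finally show ?thesis .
qed

lemma fgen_compose:
  assumes J: "ideal J R" and "fgen d J m" "fgen e J n"
  shows "fgen (d + e) J (n * m)"
proof -
  obtain Y Z where Y: "finite Y" "Y \<subseteq> carrier R" "card Y \<le> n" "fspan e Y J = carrier R"
    and Z: "finite Z" "Z \<subseteq> carrier R" "card Z \<le> m" "fspan d Z J = carrier R"
    using assms(2,3) unfolding fgen_def by blast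
  have "frob d w \<otimes> z \<in> J" if "w \<in> J" "z \<in> Z" for w z
    using that J Z frob_mem_ideal[OF J] by (auto intro!: ideal.I_r_closed)
  then have "fspan d Z J \<subseteq> fspan (d + e) ((\<lambda>(y, z). frob d y \<otimes> z) ` (Y \<times> Z)) J"
    using Y Z by (intro fspan_pushforward[OF fsub_ideal[OF J] _ _ fsub_ideal[OF J]]) auto
  then show ?thesis
    using Y Z card_products_le[of Y Z] by (intro fgenI[OF fsub_ideal[OF J]]) (auto simp: subset_eq)
qed

lemma fgen_0: assumes "ideal J R" shows "fgen 0 J 1"
proof -
  have "a \<in> fspan 0 {\<one>} J" if "a \<in> carrier R" for a
    using fspan.gen[of a \<one> "{\<one>}" 0 J] that by simp
  then show ?thesis by (intro fgenI[OF fsub_ideal[OF assms], of "{\<one>}"]) auto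
qed

lemma fgen_power:
  assumes J: "ideal J R" and 1: "fgen 1 J n"
  shows "fgen e J (n ^ e)"
proof (induction e)
  case (Suc e)
  then show ?case using fgen_compose[OF J 1 Suc] by (simp add: mult.commute)
qed (use fgen_0[OF J] in simp)

end

section \<open>Ranks over a residue domain\<close>

text \<open>An entry is tested only against the entries after it. For a closure with exchange this
  agrees with independence of the whole list, and it fits extension by \<open>Cons\<close>.\<close>

inductive indep_list :: "('a set \<Rightarrow> 'a set) \<Rightarrow> 'a list \<Rightarrow> bool" for cl where
  Nil: "indep_list cl []"
| Cons: "u \<notin> cl (set us) \<Longrightarrow> indep_list cl us \<Longrightarrow> indep_list cl (u # us)"

lemma indep_list_Cons_iff:
  "indep_list cl (u # us) \<longleftrightarrow> u \<notin> cl (set us) \<and> indep_list cl us"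
  by (subst indep_list.simps) auto

lemma steinitz:
  fixes cl :: "'a set \<Rightarrow> 'a set"
  assumes ext: "\<And>A. A \<subseteq> C \<Longrightarrow> A \<subseteq> cl A"
    and hull: "\<And>A B. A \<subseteq> C \<Longrightarrow> B \<subseteq> C \<Longrightarrow> A \<subseteq> cl B \<Longrightarrow> cl A \<subseteq> cl B"
    and exch: "\<And>A x y. A \<subseteq> C \<Longrightarrow> x \<in> C \<Longrightarrow> y \<in> C \<Longrightarrow> x \<in> cl (insert y A) \<Longrightarrow> x \<notin> cl A
      \<Longrightarrow> y \<in> cl (insert x A)"
    and us: "indep_list cl us" "set us \<subseteq> C" "set us \<subseteq> cl Y" and Y: "finite Y" "Y \<subseteq> C"
  shows "length us \<le> card Y"
proof -
  \<comment> \<open>The exchange invariant: each entry of \<open>us\<close> has replaced one element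
    of \<open>Y\<close>, and \<open>Z\<close> is what remains.\<close>
  have "\<exists>Z\<subseteq>Y. card Z + length us = card Y \<and> Y \<subseteq> cl (Z \<union> set us)"
    using us
  proof (induction us rule: list.induct)
    case Nil
    then show ?case using ext Y by auto
  next
    case (Cons u us)
    from Cons.prems(1) have u: "u \<notin> cl (set us)" and "indep_list cl us"
      by (simp_all add: indep_list_Cons_iff)
    moreover have "set us \<subseteq> C" "set us \<subseteq> cl Y" using Cons.prems by auto
    ultimately obtain Z where Z: "Z \<subseteq> Y" "card Z + length us = card Y" "Y \<subseteq> cl (Z \<union> set us)"
      using Cons.IH by blast
    have C: "u \<in> C" "set us \<subseteq> C" "Z \<subseteq> C" using Cons.prems Z Y by auto
    have "finite Z" using Z(1) Y(1) by (rule finite_subset)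
    have uZ: "u \<in> cl (Z \<union> set us)"
      using hull[of Y "Z \<union> set us"] Z Y C Cons.prems by auto
    \<comment> \<open>When the elements of \<open>Z\<close> are added one by one, \<open>u\<close>
      enters the closure at some \<open>z\<close>; \<open>W\<close> consists of those added before.
      This is the situation to which \<open>exch\<close> applies.\<close>
    have "\<exists>z\<in>Z. \<exists>W\<subseteq>Z - {z}. u \<in> cl (insert z (W \<union> set us)) \<and> u \<notin> cl (W \<union> set us)"
      using \<open>finite Z\<close> \<open>Z \<subseteq> C\<close> uZ
    proof (induction Z rule: finite_induct)
      case empty
      then show ?case using u by simp
    next
      case (insert z Z)
      show ?case
      proof (cases "u \<in> cl (Z \<union> set us)")
        case True
        then obtain z' W where "z' \<in> Z" "W \<subseteq> Z - {z'}"
          "u \<in> cl (insert z' (W \<union> set us)) \<and> u \<notin> cl (W \<union> set us)"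
          using insert by auto
        then show ?thesis by (intro bexI[of _ z'] exI[of _ W]) auto
      next
        case False
        then show ?thesis using insert by (intro bexI[of _ z] exI[of _ Z]) auto
      qed
    qed
    then obtain z W where z: "z \<in> Z" and W: "W \<subseteq> Z - {z}"
      and uW: "u \<in> cl (insert z (W \<union> set us))" "u \<notin> cl (W \<union> set us)" by blast
    let ?V = "(Z - {z}) \<union> set (u # us)"
    have V: "?V \<subseteq> C" using C by auto
    have "z \<in> cl (insert u (W \<union> set us))"
      using exch[OF _ _ _ uW] z W C by auto
    moreover have "cl (insert u (W \<union> set us)) \<subseteq> cl ?V"
      using ext[OF V] W C by (intro hull[OF _ V]) auto
    ultimately have "Z \<union> set us \<subseteq> cl ?V" using ext[OF V] by auto
    then have "cl (Z \<union> set us) \<subseteq> cl ?V" using C by (intro hull[OF _ V]) auto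
    moreover have "card (Z - {z}) + length (u # us) = card Y"
      using Z(2) card_Suc_Diff1[OF \<open>finite Z\<close> z] by simp
    ultimately show ?case using Z by (intro exI[of _ "Z - {z}"]) auto
  qed
  then show ?thesis by auto
qed

section \<open>Linear dependence over R/Q\<close>

context char_p_ring
begin

text \<open>The relative closure of \<open>S\<close> in \<open>F\<^sup>e\<^sub>*R / B\<close> viewed over the domain \<open>R / Q\<close>: it is a matroid
  closure as soon as \<open>Q\<close> annihilates \<open>F\<^sup>e\<^sub>*R / B\<close>.\<close>

definition annihilates :: "nat \<Rightarrow> 'a set \<Rightarrow> 'a set \<Rightarrow> bool" where
  "annihilates e Q B \<longleftrightarrow> primeideal Q R \<and> fsub e B
     \<and> (\<forall>s\<in>Q. \<forall>r\<in>carrier R. frob e s \<otimes> r \<in> B)"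

definition fcl :: "nat \<Rightarrow> 'a set \<Rightarrow> 'a set \<Rightarrow> 'a set \<Rightarrow> 'a set" where
  "fcl e Q B S = {r \<in> carrier R. \<exists>a\<in>carrier R - Q. frob e a \<otimes> r \<in> fspan e S B}"

lemma prime_one_notin: "primeideal Q R \<Longrightarrow> \<one> \<notin> Q"
  using primeideal.I_notcarr primeideal.axioms(1) ideal.one_imp_carrier by metis

lemma prime_mult_notin:
  "primeideal Q R \<Longrightarrow> a \<in> carrier R - Q \<Longrightarrow> b \<in> carrier R - Q \<Longrightarrow> a \<otimes> b \<in> carrier R - Q"
  using primeideal.I_prime by fastforce

lemma annihilates_prime: "primeideal Q R \<Longrightarrow> annihilates e Q Q"
  unfolding annihilates_def
  by (auto intro!: fsub_ideal ideal.I_r_closed frob_mem_ideal primeideal.axioms(1))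

context
  fixes e Q B assumes ann: "annihilates e Q B"
begin

lemma ann_prime: "primeideal Q R" and ann_fsub: "fsub e B"
  and ann_mem: "s \<in> Q \<Longrightarrow> r \<in> carrier R \<Longrightarrow> frob e s \<otimes> r \<in> B"
  using ann by (auto simp: annihilates_def)

lemma fspan_imp_fcl:
  assumes "r \<in> fspan e S B" "S \<subseteq> carrier R"
  shows "r \<in> fcl e Q B S"
proof -
  have "r \<in> carrier R" using assms fsub_fspan[OF ann_fsub] fsub_carrier by blast
  then show ?thesis using assms prime_one_notin[OF ann_prime]
    by (auto simp: fcl_def intro!: bexI[of _ \<one>])
qed

text \<open>Denominators are multiplied; the product stays outside \<open>Q\<close> because
  \<open>Q\<close> is prime.\<close>

lemma fsub_fcl:
  assumes S: "S \<subseteq> carrier R"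
  shows "fsub e (fcl e Q B S)"
  unfolding fsub_def
proof (intro conjI ballI)
  note F = fsub_fspan[OF ann_fsub S]
  show "fcl e Q B S \<subseteq> carrier R" by (auto simp: fcl_def)
  show "\<zero> \<in> fcl e Q B S" using fsub_zero[OF F] S by (rule fspan_imp_fcl)
  fix x y assume "x \<in> fcl e Q B S" "y \<in> fcl e Q B S"
  then obtain a b where a: "a \<in> carrier R - Q" "x \<in> carrier R" "frob e a \<otimes> x \<in> fspan e S B"
    and b: "b \<in> carrier R - Q" "y \<in> carrier R" "frob e b \<otimes> y \<in> fspan e S B"
    by (auto simp: fcl_def)
  have "frob e (a \<otimes> b) \<otimes> (x \<oplus> y) = frob e b \<otimes> (frob e a \<otimes> x) \<oplus> frob e a \<otimes> (frob e b \<otimes> y)"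
    using a b by (simp add: frob_mult r_distr l_distr m_ac)
  also have "\<dots> \<in> fspan e S B"
    using a b by (auto intro!: fsub_add[OF F] fsub_smult[OF F])
  finally show "x \<oplus> y \<in> fcl e Q B S"
    using a b prime_mult_notin[OF ann_prime a(1) b(1)] by (auto simp: fcl_def)
next
  note F = fsub_fspan[OF ann_fsub S]
  fix s x assume s: "s \<in> carrier R" and "x \<in> fcl e Q B S"
  then obtain a where a: "a \<in> carrier R - Q" "x \<in> carrier R" "frob e a \<otimes> x \<in> fspan e S B"
    by (auto simp: fcl_def)
  have "frob e a \<otimes> (frob e s \<otimes> x) = frob e s \<otimes> (frob e a \<otimes> x)"
    using a s by (simp add: m_ac)
  also have "\<dots> \<in> fspan e S B" using a s by (auto intro!: fsub_smult[OF F])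
  finally show "frob e s \<otimes> x \<in> fcl e Q B S" using a s by (auto simp: fcl_def)
qed

lemma fcl_divide:
  assumes "a \<in> carrier R - Q" "r \<in> carrier R" "frob e a \<otimes> r \<in> fcl e Q B S"
  shows "r \<in> fcl e Q B S"
proof -
  obtain b where b: "b \<in> carrier R - Q" "frob e b \<otimes> (frob e a \<otimes> r) \<in> fspan e S B"
    using assms by (auto simp: fcl_def)
  have "frob e (b \<otimes> a) \<otimes> r \<in> fspan e S B" using b assms by (simp add: frob_mult m_assoc)
  then show ?thesis using assms prime_mult_notin[OF ann_prime b(1) assms(1)] by (auto simp: fcl_def)
qed

lemma fcl_hull:
  assumes S: "S \<subseteq> carrier R" and D: "D \<subseteq> carrier R" and SD: "S \<subseteq> fcl e Q B D"
  shows "fcl e Q B S \<subseteq> fcl e Q B D"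
proof
  fix r assume "r \<in> fcl e Q B S"
  then obtain a where a: "a \<in> carrier R - Q" "r \<in> carrier R" "frob e a \<otimes> r \<in> fspan e S B"
    by (auto simp: fcl_def)
  have "B \<subseteq> fcl e Q B D" using fspan_imp_fcl D by (auto intro: fspan.base)
  then have "fspan e S B \<subseteq> fcl e Q B D" using SD by (intro fspan_minimal fsub_fcl D)
  then show "r \<in> fcl e Q B D" using a fcl_divide by blast
qed

lemma fcl_exchange:
  assumes S: "S \<subseteq> carrier R" and x: "x \<in> carrier R" and y: "y \<in> carrier R"
    and xy: "x \<in> fcl e Q B (insert y S)" and nx: "x \<notin> fcl e Q B S"
  shows "y \<in> fcl e Q B (insert x S)"
proof -
  obtain a where a: "a \<in> carrier R - Q" "frob e a \<otimes> x \<in> fspan e (insert y S) B"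
    using xy by (auto simp: fcl_def)
  obtain s w where s: "s \<in> carrier R" and w: "w \<in> fspan e S B"
    and eq: "frob e a \<otimes> x = frob e s \<otimes> y \<oplus> w"
    using fspan_insert_decomp[OF ann_fsub S y a(2)] .
  note F = fsub_fspan[OF ann_fsub S]
  have wc: "w \<in> carrier R" using w F fsub_carrier by blast
  \<comment> \<open>Otherwise the term with \<open>y\<close> would lie in \<open>B\<close>, since
    \<open>Q\<close> annihilates the quotient, and \<open>x\<close> would depend on \<open>S\<close>
    alone. With \<open>s\<close> outside \<open>Q\<close> the relation can be solved for
    \<open>y\<close>.\<close>
  have "s \<notin> Q"
  proof
    assume "s \<in> Q"
    then have "frob e a \<otimes> x \<in> fspan e S B"
      unfolding eq using ann_mem y w by (auto intro: fspan.intros)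
    then show False using nx a x by (auto simp: fcl_def)
  qed
  moreover have "frob e s \<otimes> y = frob e a \<otimes> x \<oplus> \<ominus> w"
    unfolding eq using s y wc by (simp add: a_assoc r_neg)
  moreover have "\<ominus> w \<in> fspan e (insert x S) B"
    using fsub_minus[OF F w] fspan_mono[of S "insert x S" B B] by auto
  ultimately have "frob e s \<otimes> y \<in> fspan e (insert x S) B"
    using a by (auto intro: fspan.intros)
  then show ?thesis using s y \<open>s \<notin> Q\<close> by (auto simp: fcl_def)
qed

text \<open>Rank bounds the number of generators. This serves twice: with \<open>Q = B = P\<close>
  for ranks over D, and with \<open>Q = \<mm>\<close>, \<open>B = I_e\<close> for dimensions over
  the residue field.\<close>

lemma indep_length_le:
  assumes "indep_list (fcl e Q B) us" "set us \<subseteq> carrier R" and "fgen e B n"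
  shows "length us \<le> n"
proof -
  obtain Y where Y: "finite Y" "Y \<subseteq> carrier R" "card Y \<le> n" "fspan e Y B = carrier R"
    using assms(3) unfolding fgen_def by blast
  have "length us \<le> card Y"
  proof (rule steinitz[where C = "carrier R" and cl = "fcl e Q B"])
    show "set us \<subseteq> fcl e Q B Y" using assms(2) Y by (auto intro: fspan_imp_fcl)
  qed (use assms Y fcl_hull fcl_exchange in \<open>auto intro!: fspan_imp_fcl fspan_mem\<close>)
  then show ?thesis using Y by simp
qed

end

text \<open>The products are ordered lexicographically, so a relation between them is a relation over the
  \<open>us\<close> whose leading coefficient is the image under \<open>F\<^sup>d\<close> of a relation over the \<open>ws\<close>.\<close>

lemma indep_products:
  assumes Q: "primeideal Q R" and us: "indep_list (fcl d Q Q) us" "set us \<subseteq> carrier R"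
    and ws: "indep_list (fcl e Q Q) ws" "set ws \<subseteq> carrier R"
  shows "indep_list (fcl (d + e) Q Q) (concat (map (\<lambda>u. map (\<lambda>w. u \<otimes> frob d w) ws) us))"
  using us
proof (induction us rule: list.induct)
  case Nil
  then show ?case by (simp add: indep_list.Nil)
next
  case (Cons u us)
  let ?V = "set (concat (map (\<lambda>u. map (\<lambda>w. u \<otimes> frob d w) ws) us))"
  have u: "u \<in> carrier R" "u \<notin> fcl d Q Q (set us)" and usi: "indep_list (fcl d Q Q) us"
    and usc: "set us \<subseteq> carrier R"
    using Cons.prems by (simp_all add: indep_list_Cons_iff)
  note IQ = primeideal.axioms(1)[OF Q]
  \<comment> \<open>The leading coefficient is isolated: \<open>t\<close> collects the products with
    \<open>u\<close>, and \<open>r\<close> those with entries of \<open>us\<close>.\<close>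
  have *: "\<exists>t\<in>fspan e (set vs) Q. \<exists>r\<in>fspan d (set us) Q. a = u \<otimes> frob d t \<oplus> r"
    if vs: "set vs \<subseteq> set ws" and a: "a \<in> fspan (d + e) (set (map (\<lambda>w. u \<otimes> frob d w) vs) \<union> ?V) Q"
    for vs a
    using a
  proof induction
    case (base b)
    then have "b = u \<otimes> frob d \<zero> \<oplus> b" using u ideal.Icarr[OF IQ] by simp
    then show ?case using base fsub_zero[OF fsub_ideal[OF IQ, of e]]
      by (blast intro: fspan.base)
  next
    case (gen s x)
    then consider w where "w \<in> set vs" "x = u \<otimes> frob d w"
      | u' w where "u' \<in> set us" "w \<in> set ws" "x = u' \<otimes> frob d w"
      by auto
    then show ?case
    proof cases
      case 1
      then have w: "w \<in> carrier R" using vs ws by auto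
      then have "frob (d + e) s \<otimes> x = u \<otimes> frob d (frob e s \<otimes> w) \<oplus> \<zero>"
        using 1 u gen by (simp add: frob_mult m_ac)
      then show ?thesis using 1 gen fsub_zero[OF fsub_ideal[OF IQ, of d]]
        by (blast intro: fspan.intros)
    next
      case 2
      then have w: "w \<in> carrier R" "u' \<in> carrier R" using ws usc by auto
      then have "frob (d + e) s \<otimes> x = u \<otimes> frob d \<zero> \<oplus> frob d (frob e s \<otimes> w) \<otimes> u'"
        using 2 u gen by (simp add: frob_mult m_ac)
      moreover have "frob d (frob e s \<otimes> w) \<otimes> u' \<in> fspan d (set us) Q"
        using 2 gen w by (intro fspan.gen) auto
      ultimately show ?thesis using fsub_zero[OF fsub_ideal[OF IQ, of e]]
        by (blast intro: fspan.base)
    qed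
  next
    case (add a b)
    then obtain t r t' r' where *: "t \<in> fspan e (set vs) Q" "r \<in> fspan d (set us) Q"
      "a = u \<otimes> frob d t \<oplus> r" "t' \<in> fspan e (set vs) Q" "r' \<in> fspan d (set us) Q"
      "b = u \<otimes> frob d t' \<oplus> r'" by blast
    have "set vs \<subseteq> carrier R" using vs ws by auto
    then have "t \<in> carrier R" "t' \<in> carrier R" "r \<in> carrier R" "r' \<in> carrier R"
      using * fsub_carrier[OF fsub_fspan[OF fsub_ideal[OF IQ]]] usc by blast+
    then have "a \<oplus> b = u \<otimes> frob d (t \<oplus> t') \<oplus> (r \<oplus> r')"
      using * u by (simp add: frob_add r_distr a_ac)
    then show ?case using * by (blast intro: fspan.add)
  qed
  have "indep_list (fcl (d + e) Q Q)
      (map (\<lambda>w. u \<otimes> frob d w) vs @ concat (map (\<lambda>u. map (\<lambda>w. u \<otimes> frob d w) ws) us))"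
    if "indep_list (fcl e Q Q) vs" "set vs \<subseteq> set ws" for vs
    using that
  proof (induction vs rule: list.induct)
    case Nil
    then show ?case using Cons.IH[OF usi usc] by simp
  next
    case (Cons v vs)
    have v: "v \<in> carrier R" "v \<notin> fcl e Q Q (set vs)" and vsi: "indep_list (fcl e Q Q) vs"
      and vs: "set vs \<subseteq> set ws"
      using Cons.prems ws by (auto simp add: indep_list_Cons_iff)
    then have vsc: "set vs \<subseteq> carrier R" using ws by auto
    have "u \<otimes> frob d v \<notin> fcl (d + e) Q Q (set (map (\<lambda>w. u \<otimes> frob d w) vs) \<union> ?V)"
    proof
      assume "u \<otimes> frob d v \<in> fcl (d + e) Q Q (set (map (\<lambda>w. u \<otimes> frob d w) vs) \<union> ?V)"
      then obtain a where a: "a \<in> carrier R - Q"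
        "frob (d + e) a \<otimes> (u \<otimes> frob d v) \<in> fspan (d + e) (set (map (\<lambda>w. u \<otimes> frob d w) vs) \<union> ?V) Q"
        by (auto simp: fcl_def)
      obtain t r where t: "t \<in> fspan e (set vs) Q" and r: "r \<in> fspan d (set us) Q"
        and eq: "frob (d + e) a \<otimes> (u \<otimes> frob d v) = u \<otimes> frob d t \<oplus> r"
        using *[OF vs a(2)] by blast
      have tc: "t \<in> carrier R" and rc: "r \<in> carrier R"
        using t r fsub_carrier[OF fsub_fspan[OF fsub_ideal[OF IQ]]] usc vsc by blast+
      \<comment> \<open>Subtracting the leading part leaves a multiple of \<open>u\<close> in the
        span of \<open>us\<close>. Independence of \<open>u\<close> forces its coefficient into
        \<open>Q\<close>, which makes \<open>v\<close> depend on \<open>vs\<close>.\<close>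
      have "frob d (frob e a \<otimes> v \<ominus> t) \<otimes> u = frob (d + e) a \<otimes> (u \<otimes> frob d v) \<ominus> u \<otimes> frob d t"
        using a u v tc by (simp add: a_minus_def frob_add frob_minus frob_mult r_distr r_minus l_distr l_minus m_ac)
      also have "\<dots> = r" unfolding eq using u tc rc by (simp add: a_minus_def a_ac r_neg r_neg1 r_neg2)
      finally have "frob d (frob e a \<otimes> v \<ominus> t) \<otimes> u \<in> fspan d (set us) Q" using r by simp
      moreover have "frob e a \<otimes> v \<ominus> t \<in> carrier R" using a v tc by simp
      ultimately have q: "frob e a \<otimes> v \<ominus> t \<in> Q" using u by (auto simp: fcl_def)
      have "frob e a \<otimes> v = (frob e a \<otimes> v \<ominus> t) \<oplus> t"
        using a v tc by (simp add: a_minus_def a_assoc l_neg)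
      also have "\<dots> \<in> fspan e (set vs) Q" using q t by (auto intro: fspan.intros)
      finally show False using v a by (auto simp: fcl_def)
    qed
    then show ?case using Cons.IH[OF vsi vs] by (auto intro: indep_list.Cons)
  qed
  from this[OF ws(1)] show ?case by simp
qed

lemma indep_power:
  assumes Q: "primeideal Q R" and us: "indep_list (fcl 1 Q Q) us" "set us \<subseteq> carrier R"
  shows "\<exists>ws. indep_list (fcl e Q Q) ws \<and> set ws \<subseteq> carrier R \<and> length ws = length us ^ e"
proof (induction e)
  case 0
  \<comment> \<open>R/Q has rank one over itself.\<close>
  have "\<one> \<notin> fcl 0 Q Q {}"
  proof
    assume "\<one> \<in> fcl 0 Q Q {}"
    then obtain a where "a \<in> carrier R - Q" "a \<in> fspan 0 {} Q" by (auto simp: fcl_def)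
    moreover have "fspan 0 {} Q \<subseteq> Q"
      by (intro fspan_minimal fsub_ideal primeideal.axioms(1)[OF Q]) auto
    ultimately show False by auto
  qed
  then have "indep_list (fcl 0 Q Q) [\<one>]" by (auto intro!: indep_list.intros)
  then show ?case by (intro exI[of _ "[\<one>]"]) auto
next
  case (Suc e)
  then obtain ws where ws: "indep_list (fcl e Q Q) ws" "set ws \<subseteq> carrier R"
    "length ws = length us ^ e" by blast
  let ?vs = "concat (map (\<lambda>u. map (\<lambda>w. u \<otimes> frob 1 w) ws) us)"
  have "length ?vs = length us ^ Suc e"
    using ws(3) by (simp add: length_concat comp_def sum_list_triv)
  moreover have "set ?vs \<subseteq> carrier R" using us ws by auto
  ultimately show ?case
    using indep_products[OF Q us ws(1,2)] by (intro exI[of _ ?vs]) (simp only: plus_1_eq_Suc)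
qed

end

section \<open>Growth of the number of generators\<close>

lemma (in cring) ideal_add_principal:
  assumes J: "ideal J R" and x: "x \<in> carrier R"
  shows "J \<subseteq> J <+>\<^bsub>R\<^esub> PIdl x" "x \<in> J <+>\<^bsub>R\<^esub> PIdl x"
proof -
  have zero: "\<zero> \<in> I" if "ideal I R" for I
    by (rule additive_subgroup.zero_closed[OF ideal.axioms(1)[OF that]])
  note z = zero[OF cgenideal_ideal[OF x]] cgenideal_self[OF x] zero[OF J]
  have "j \<in> J <+>\<^bsub>R\<^esub> PIdl x" if "j \<in> J" for j
  proof -
    have "j = j \<oplus> \<zero>" using ideal.Icarr[OF J that] by simp
    then show ?thesis using that z unfolding set_add_def' by blast
  qed
  then show "J \<subseteq> J <+>\<^bsub>R\<^esub> PIdl x" by blast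
  have "x = \<zero> \<oplus> x" using x by simp
  then show "x \<in> J <+>\<^bsub>R\<^esub> PIdl x" using z unfolding set_add_def' by blast
qed

text \<open>A nonempty chain of ideals contains its own union in a Noetherian ring, so Zorn's lemma
  applies to an arbitrary family.\<close>

lemma (in noetherian_ring) exists_maximal_ideal_in:
  assumes "A \<noteq> {}" "\<And>I. I \<in> A \<Longrightarrow> ideal I R"
  obtains M where "M \<in> A" "\<And>I. I \<in> A \<Longrightarrow> M \<subseteq> I \<Longrightarrow> I = M"
proof -
  have "\<exists>M\<in>A. \<forall>I\<in>A. M \<subseteq> I \<longrightarrow> I = M"
  proof (rule subset_Zorn_nonempty[OF assms(1)])
    fix C assume C: "C \<noteq> {}" "subset.chain A C"
    then have "subset.chain {I. ideal I R} C" using assms(2) by (auto simp: pred_on.chain_def)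
    then have "\<Union>C \<in> C" using C ideal_chain_is_trivial by blast
    then show "\<Union>C \<in> A" using C by (auto simp: pred_on.chain_def)
  qed
  then show thesis using that by blast
qed

lemma (in noetherian_ring) noetherian_induct [consumes 1, case_names step]:
  assumes "ideal J R"
    and step: "\<And>J. ideal J R \<Longrightarrow> (\<And>I. ideal I R \<Longrightarrow> J \<subset> I \<Longrightarrow> P I) \<Longrightarrow> P J"
  shows "P J"
proof (rule ccontr)
  assume "\<not> P J"
  then have "{I. ideal I R \<and> \<not> P I} \<noteq> {}" using assms(1) by auto
  then obtain M where M: "M \<in> {I. ideal I R \<and> \<not> P I}"
    and max: "\<And>I. I \<in> {I. ideal I R \<and> \<not> P I} \<Longrightarrow> M \<subseteq> I \<Longrightarrow> I = M"
    by (rule exists_maximal_ideal_in) auto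
  have "P M"
  proof (rule step)
    show "ideal M R" using M by simp
    show "P I" if "ideal I R" "M \<subset> I" for I using max[of I] that by auto
  qed
  then show False using M by simp
qed

context noetherian_local_ring
begin

lemma proper_ideal_subset:
  assumes "ideal J R" "J \<noteq> carrier R"
  shows "J \<subseteq> \<mm>"
proof -
  let ?A = "{I. ideal I R \<and> J \<subseteq> I \<and> I \<noteq> carrier R}"
  have "?A \<noteq> {}" using assms by auto
  then obtain M where M: "M \<in> ?A" and max: "\<And>I. I \<in> ?A \<Longrightarrow> M \<subseteq> I \<Longrightarrow> I = M"
    by (rule exists_maximal_ideal_in) auto
  have "maximalideal M R"
  proof (rule maximalidealI)
    show "ideal M R" "carrier R \<noteq> M" using M by auto
    fix I assume I: "ideal I R" "M \<subseteq> I" "I \<subseteq> carrier R"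
    show "I = M \<or> I = carrier R"
    proof (cases "I = carrier R")
      case False
      then have "I \<in> ?A" using I M by auto
      then show ?thesis using max I by simp
    qed simp
  qed
  then have "M = \<mm>" by (rule maximal_unique)
  then show ?thesis using M by simp
qed

lemma unit_of_notin:
  assumes "a \<in> carrier R" "a \<notin> \<mm>"
  obtains b where "b \<in> carrier R" "a \<otimes> b = \<one>"
proof -
  have "PIdl a = carrier R"
    using proper_ideal_subset[OF cgenideal_ideal[OF assms(1)]] cgenideal_self[OF assms(1)] assms(2)
    by auto
  then have "\<one> \<in> PIdl a" by simp
  then show thesis using that assms by (auto simp: cgenideal_def m_comm)
qed

lemma prime_mm: "primeideal \<mm> R"
  using maximalideal_prime maximalideal_axioms by blast

lemma one_notin_mm: "\<one> \<notin> \<mm>"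
  using one_imp_carrier I_notcarr by auto

text \<open>The bound \<open>\<delta>\<close> is on the number \<open>m + 1\<close> of primes in the chain. For a proper ideal \<open>J\<close> it thus says
  \<open>dim R/J < \<delta>\<close>, and for \<open>\<delta> = 0\<close> it says \<open>J = R\<close>.\<close>

definition prime_chains_le :: "'a set \<Rightarrow> nat \<Rightarrow> bool" where
  "prime_chains_le J \<delta> \<longleftrightarrow> (\<forall>m f. (\<forall>i\<le>m. primeideal (f i) R \<and> J \<subseteq> f i)
     \<and> (\<forall>i<m. f i \<subset> f (Suc i)) \<longrightarrow> m < \<delta>)"

lemma prime_chains_le_mono: "prime_chains_le J \<delta> \<Longrightarrow> J \<subseteq> I \<Longrightarrow> prime_chains_le I \<delta>"
  unfolding prime_chains_le_def by blast

lemma prime_chains_le_0: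
  assumes "prime_chains_le J 0" "ideal J R"
  shows "J = carrier R"
proof (rule ccontr)
  assume "J \<noteq> carrier R"
  then have "J \<subseteq> \<mm>" using proper_ideal_subset assms by blast
  then show False
    using assms(1)[unfolded prime_chains_le_def, rule_format, of 0 "\<lambda>_. \<mm>"] prime_mm by simp
qed

text \<open>A prime above \<open>I\<close> contains \<open>x\<close> and so lies strictly above
  \<open>Q\<close>; prepending \<open>Q\<close> lengthens every chain above \<open>I\<close> by
  one.\<close>

lemma prime_chains_le_add_principal:
  assumes Q: "primeideal Q R" "prime_chains_le Q (Suc \<delta>)" and x: "x \<notin> Q" and "Q \<subseteq> I" "x \<in> I"
  shows "prime_chains_le I \<delta>"
  unfolding prime_chains_le_def
proof (intro allI impI)
  fix m f assume f: "(\<forall>i\<le>m. primeideal (f i) R \<and> I \<subseteq> f i) \<and> (\<forall>i<m. f i \<subset> f (Suc i))"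
  let ?g = "\<lambda>i. case i of 0 \<Rightarrow> Q | Suc i \<Rightarrow> f i"
  have "(\<forall>i\<le>Suc m. primeideal (?g i) R \<and> Q \<subseteq> ?g i) \<and> (\<forall>i<Suc m. ?g i \<subset> ?g (Suc i))"
    using f assms by (auto split: nat.splits)
  then have "Suc m < Suc \<delta>" using Q(2) unfolding prime_chains_le_def by blast
  then show "m < \<delta>" by simp
qed

end

section \<open>Generator numbers over an F-finite local ring\<close>

locale F_finite_local_ring = char_p_ring R p + noetherian_local_ring R \<mm>
  for R (structure) and \<mm> and p +
  assumes F_fin: "F_finite p R"
begin

lemma frobenius_pushforward_simps [simp]:
  "carrier (frobenius_pushforward p R e) = carrier R"
  "\<zero>\<^bsub>frobenius_pushforward p R e\<^esub> = \<zero>"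
  "ring.add (frobenius_pushforward p R e) = ring.add R"
  "s \<odot>\<^bsub>frobenius_pushforward p R e\<^esub> r = frob e s \<otimes> r"
  by (simp_all add: frobenius_pushforward_def frob_def)

lemma subgroup_frobenius_pushforward:
  "subgroup N (add_monoid (frobenius_pushforward p R e)) \<longleftrightarrow> subgroup N (add_monoid R)"
  by (simp add: subgroup_def m_inv_def)

lemma submodule_iff_fsub: "submodule N R (frobenius_pushforward p R e) \<longleftrightarrow> fsub e N"
proof
  assume "submodule N R (frobenius_pushforward p R e)"
  then interpret submodule N R "frobenius_pushforward p R e" .
  show "fsub e N"
    using subset one_closed m_closed smult_closed by (auto simp: fsub_def)
next
  assume N: "fsub e N"
  have "subgroup N (add_monoid R)"
    using fsub_carrier[OF N] fsub_zero[OF N] fsub_add[OF N] fsub_minus[OF N]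
    by (intro add.subgroupI) auto
  then show "submodule N R (frobenius_pushforward p R e)"
    using fsub_smult[OF N]
    by (intro submodule.intro submodule_axioms.intro subgroup_frobenius_pushforward[THEN iffD2]) auto
qed

lemma fgen_1: obtains n where "fgen 1 {\<zero>} n"
proof -
  obtain A where A: "finite A" "A \<subseteq> carrier R"
    "\<And>N. submodule N R (frobenius_pushforward p R 1) \<Longrightarrow> A \<subseteq> N \<Longrightarrow> N = carrier R"
    using F_fin unfolding F_finite_def finitely_generated_module_def by auto
  have "fspan 1 A {\<zero>} = carrier R"
    using A fsub_fspan[of 1 "{\<zero>}" A] by (intro A(3)) (auto simp: submodule_iff_fsub intro: fspan_mem)
  then have "fgen 1 {\<zero>} (card A)" using A by (auto simp: fgen_def)
  then show thesis by (rule that)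
qed

lemma fgen_finite: obtains n where "fgen e {\<zero>} n"
  using fgen_1 fgen_power[OF zeroideal] by metis

text \<open>The generators in \<open>Z\<close> are eliminated one at a time. If z = a + x t and t =
  s z + w, with scalars acting through \<open>frob e\<close>, then (1 - x s) z lies in the span of
  the other generators over \<open>A\<close>, and 1 - x s is a unit because x is in the maximal
  ideal.\<close>

lemma nakayama:
  assumes "finite Z" "Z \<subseteq> carrier R" and A: "fsub e A" and x: "x \<in> \<mm>"
    and Ax: "\<And>r. r \<in> carrier R \<Longrightarrow> \<exists>a\<in>A. \<exists>t\<in>carrier R. r = a \<oplus> frob e x \<otimes> t"
    and "fspan e Z A = carrier R"
  shows "A = carrier R"
  using assms(1,2,6)
proof (induction Z rule: finite_induct)
  case empty
  then show ?case using fspan_minimal[OF A, of A "{}"] A by (auto simp: fsub_def)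
next
  case (insert z Z)
  have xc: "x \<in> carrier R" using x Icarr by blast
  have zc: "z \<in> carrier R" and Zc: "Z \<subseteq> carrier R" using insert by auto
  note F = fsub_fspan[OF A Zc]
  obtain a t where a: "a \<in> A" and t: "t \<in> carrier R" and z: "z = a \<oplus> frob e x \<otimes> t"
    using Ax zc by blast
  have "t \<in> fspan e (insert z Z) A" using insert t by simp
  then obtain s w where s: "s \<in> carrier R" and w: "w \<in> fspan e Z A" and tw: "t = frob e s \<otimes> z \<oplus> w"
    using fspan_insert_decomp[OF A Zc zc] by blast
  have wc: "w \<in> carrier R" and ac: "a \<in> carrier R" using w a F A fsub_carrier by blast+
  let ?c = "\<one> \<ominus> x \<otimes> s"
  have xs: "x \<otimes> s \<in> \<mm>" using x s I_r_closed by blast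
  have "?c \<notin> \<mm>"
  proof
    assume "?c \<in> \<mm>"
    then have "?c \<oplus> x \<otimes> s \<in> \<mm>" using xs by blast
    then show False using one_notin_mm xc s by (simp add: a_minus_def a_assoc l_neg)
  qed
  moreover have "?c \<in> carrier R" using xc s by simp
  ultimately obtain b where b: "b \<in> carrier R" "?c \<otimes> b = \<one>" using unit_of_notin by blast
  have "z = a \<oplus> frob e x \<otimes> (frob e s \<otimes> z \<oplus> w)" using z unfolding tw .
  also have "\<dots> = frob e (x \<otimes> s) \<otimes> z \<oplus> (a \<oplus> frob e x \<otimes> w)"
    using xc s zc wc ac by (simp add: frob_mult r_distr m_assoc a_lcomm)
  finally have eq: "z = frob e (x \<otimes> s) \<otimes> z \<oplus> (a \<oplus> frob e x \<otimes> w)" .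
  have "frob e ?c \<otimes> z = \<ominus> (frob e (x \<otimes> s) \<otimes> z) \<oplus> z"
    using xc s zc by (simp add: a_minus_def frob_add frob_minus l_distr l_minus a_comm)
  also have "\<dots> = \<ominus> (frob e (x \<otimes> s) \<otimes> z) \<oplus> (frob e (x \<otimes> s) \<otimes> z \<oplus> (a \<oplus> frob e x \<otimes> w))"
    using eq by (rule arg_cong)
  also have "\<dots> = a \<oplus> frob e x \<otimes> w"
    using xc s zc wc ac by (intro r_neg1) auto
  finally have "frob e ?c \<otimes> z = a \<oplus> frob e x \<otimes> w" .
  also have "\<dots> \<in> fspan e Z A"
    using a w xc fsub_add[OF F] fsub_smult[OF F] by (auto intro: fspan.base)
  finally have "frob e b \<otimes> (frob e ?c \<otimes> z) \<in> fspan e Z A" using b fsub_smult[OF F] by blast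
  moreover have "frob e b \<otimes> (frob e c \<otimes> z) = frob e (c \<otimes> b) \<otimes> z" if "c \<in> carrier R" for c
    using b(1) zc that by (simp add: frob_mult m_ac)
  from this[of ?c] have "frob e b \<otimes> (frob e ?c \<otimes> z) = z"
    using b(2) xc s zc by simp
  ultimately have "z \<in> fspan e Z A" by (simp only:)
  then have "fspan e (insert z Z) A \<subseteq> fspan e Z A"
    using Zc by (intro fspan_minimal[OF F]) (auto intro: fspan.base fspan_mem)
  then have "fspan e Z A = carrier R" using insert F by (auto simp: fsub_def)
  then show ?case using insert Zc by blast
qed

text \<open>\<open>F\<^sup>e\<^sub>*(R/Q)\<close> is filtered by the powers \<open>x\<^sup>i\<close>, \<open>i < p\<^sup>e\<close>, since \<open>x\<close> acts on it as \<open>x\<^bsup>p^e\<^esup>\<close>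
  and Nakayama's lemma applies.\<close>

lemma fgen_of_principal:
  assumes Q: "ideal Q R" and x: "x \<in> \<mm>" and h: "fgen e (Q <+>\<^bsub>R\<^esub> PIdl x) h"
  shows "fgen e Q (p ^ e * h)"
proof -
  have xc: "x \<in> carrier R" using x Icarr by blast
  note IQ = fsub_ideal[OF Q] and IJ = fsub_ideal[OF add_ideals[OF Q cgenideal_ideal[OF xc]]]
  obtain Y where Y: "finite Y" "Y \<subseteq> carrier R" "card Y \<le> h" "fspan e Y (Q <+>\<^bsub>R\<^esub> PIdl x) = carrier R"
    using h unfolding fgen_def by blast
  let ?W = "(\<lambda>(i, y). x [^] i \<otimes> y) ` ({..<p ^ e} \<times> Y)"
  have W: "finite ?W" "?W \<subseteq> carrier R" using Y xc by (auto simp: subset_eq)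
  note F = fsub_fspan[OF IQ[of e] W(2)]
  have low: "x [^] i \<otimes> w \<in> fspan e ?W Q" if "i < p ^ e" "w \<in> fspan e Y {\<zero>}" for i :: nat and w
    using that(2)
  proof induction
    case (base b)
    then show ?case using xc fsub_zero[OF F] by auto
  next
    case (gen s y)
    then have eq: "x [^] i \<otimes> (frob e s \<otimes> y) = frob e s \<otimes> (x [^] i \<otimes> y)"
      using xc Y by (auto simp: m_ac subset_eq)
    have "x [^] i \<otimes> y \<in> ?W" using gen that(1) by auto
    then show ?case unfolding eq by (rule fspan.gen[OF gen(1)])
  next
    case (add a b)
    then have "a \<in> carrier R" "b \<in> carrier R"
      using Y fsub_carrier[OF fsub_fspan[OF fsub_zero_set]] by blast+
    then show ?case using add xc by (auto simp: r_distr intro: fspan.add)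
  qed
  \<comment> \<open>Each round expands \<open>t\<close> modulo Q + xR and trades the error
    \<open>x [^] j \<otimes> t\<close> for one with exponent \<open>Suc j\<close>. At
    \<open>j = p ^ e\<close> the error is a multiple of \<open>frob e x\<close>, the form that
    \<open>nakayama\<close> expects.\<close>
  have approx: "\<exists>a\<in>fspan e ?W Q. \<exists>t\<in>carrier R. r = a \<oplus> x [^] j \<otimes> t"
    if "j \<le> p ^ e" "r \<in> carrier R" for j :: nat and r
    using that(1)
  proof (induction j)
    case 0
    then show ?case using that(2) fsub_zero[OF F] by (intro bexI[of _ \<zero>] bexI[of _ r]) auto
  next
    case (Suc j)
    then obtain a t where a: "a \<in> fspan e ?W Q" and t: "t \<in> carrier R" and r: "r = a \<oplus> x [^] j \<otimes> t"
      by auto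
    obtain w b where w: "w \<in> fspan e Y {\<zero>}" and b: "b \<in> Q <+>\<^bsub>R\<^esub> PIdl x" and tw: "t = w \<oplus> b"
      using fspan_decomp[OF IJ Y(2)] t Y(4) by blast
    obtain c u where c: "c \<in> Q" "u \<in> carrier R" and bc: "b = c \<oplus> u \<otimes> x"
      using b by (auto simp: set_add_def' cgenideal_def)
    have cc: "a \<in> carrier R" "w \<in> carrier R" "c \<in> carrier R"
      using a w c Y(2) fsub_carrier[OF F] fsub_carrier[OF fsub_fspan[OF fsub_zero_set]]
        fsub_carrier[OF IQ] by blast+
    have "r = (a \<oplus> (x [^] j \<otimes> w \<oplus> x [^] j \<otimes> c)) \<oplus> x [^] Suc j \<otimes> u"
      unfolding r tw bc using cc c xc by (simp add: r_distr a_ac m_ac)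
    moreover have "a \<oplus> (x [^] j \<otimes> w \<oplus> x [^] j \<otimes> c) \<in> fspan e ?W Q"
    proof (intro fsub_add[OF F] a)
      show "x [^] j \<otimes> w \<in> fspan e ?W Q" using low w Suc by auto
      show "x [^] j \<otimes> c \<in> fspan e ?W Q"
        using c xc ideal.I_l_closed[OF Q] by (auto intro: fspan.base)
    qed
    ultimately show ?case using c by blast
  qed
  obtain n where "fgen e {\<zero>} n" by (rule fgen_finite)
  then obtain Z where Z: "finite Z" "Z \<subseteq> carrier R" "fspan e Z {\<zero>} = carrier R"
    unfolding fgen_def by blast
  have "fspan e Z {\<zero>} \<subseteq> fspan e Z (fspan e ?W Q)"
    using fsub_zero[OF F] by (intro fspan_mono) auto
  then have "fspan e Z (fspan e ?W Q) = carrier R"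
    using Z fsub_fspan[OF F Z(2)] by (auto simp: fsub_def)
  then have "fspan e ?W Q = carrier R"
    using approx[of "p ^ e"] by (intro nakayama[OF Z(1,2) F x]) (auto simp: frob_def)
  moreover have "card ?W \<le> p ^ e * h"
    using Y by (intro card_products_le) auto
  ultimately show ?thesis using W by (intro fgenI[OF IQ W]) auto
qed

text \<open>F^e_* is applied to the exact sequence 0 \<rightarrow> R/(J : a) \<rightarrow> R/J
  \<rightarrow> R/(J + aR) \<rightarrow> 0, whose first map is multiplication by
  \<open>a\<close>.\<close>

lemma fgen_split:
  assumes J: "ideal J R" and a: "a \<in> carrier R" and m: "fgen e (J <+>\<^bsub>R\<^esub> PIdl a) m"
    and n: "fgen e {r \<in> carrier R. a \<otimes> r \<in> J} n"
  shows "fgen e J (m + n)"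
proof -
  let ?K = "{r \<in> carrier R. a \<otimes> r \<in> J}"
  have K: "ideal ?K R" using ideal.helper_max_prime[OF J is_cring a] .
  obtain Y where Y: "finite Y" "Y \<subseteq> carrier R" "card Y \<le> n" "fspan e Y ?K = carrier R"
    using n unfolding fgen_def by blast
  let ?Z = "(\<lambda>y. a \<otimes> y) ` Y"
  have Z: "finite ?Z" "?Z \<subseteq> carrier R" using Y a by auto
  have *: "a \<otimes> t \<in> fspan e ?Z J" if "t \<in> fspan e Y ?K" for t
    using that
  proof induction
    case (base b)
    then show ?case by (auto intro: fspan.base)
  next
    case (gen s y)
    then have "a \<otimes> (frob e s \<otimes> y) = frob e s \<otimes> (a \<otimes> y)" using a Y by (auto simp: m_ac subset_eq)
    then show ?case using gen by (auto intro: fspan.gen)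
  next
    case (add t u)
    then have "t \<in> carrier R" "u \<in> carrier R" using Y by auto
    then show ?case using add a by (auto simp: r_distr intro: fspan.add)
  qed
  have "J <+>\<^bsub>R\<^esub> PIdl a \<subseteq> fspan e ?Z J"
  proof
    fix r assume "r \<in> J <+>\<^bsub>R\<^esub> PIdl a"
    then obtain c u where "c \<in> J" "u \<in> carrier R" "r = c \<oplus> u \<otimes> a"
      by (auto simp: set_add_def' cgenideal_def)
    then show "r \<in> fspan e ?Z J"
      using *[of u] Y a by (auto simp: m_comm intro: fspan.base fspan.add)
  qed
  then have "fgen e J (m + card ?Z)"
    using m Z fgen_trans[OF fsub_ideal[OF add_ideals[OF J cgenideal_ideal[OF a]]] fsub_ideal[OF J]]
    by blast
  moreover have "card ?Z \<le> n" using Y card_image_le[of Y "\<lambda>y. a \<otimes> y"] by linarith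
  ultimately show ?thesis unfolding fgen_def by (meson add_left_mono order_trans)
qed

text \<open>Since \<open>\<delta>\<close> bounds the number of primes in a chain, it exceeds a bound
  on the dimension by one; the factor \<open>p ^ e\<close> on the left makes up for this without a
  subtraction and lets the induction start at the unit ideal. The constant \<open>C\<close> is
  chosen before \<open>e\<close>. Noetherian induction on \<open>J\<close> runs inside the induction
  on \<open>\<delta>\<close>.\<close>

lemma dimension_bound:
  assumes \<kappa>: "fgen 1 \<mm> \<kappa>" and "ideal J R" "prime_chains_le J \<delta>"
  shows "\<exists>C. \<forall>e. \<exists>h. fgen e J h \<and> h * p ^ e \<le> C * (\<kappa> * p ^ \<delta>) ^ e"
  using assms(2,3)
proof (induction \<delta> arbitrary: J)
  case 0
  then have "J = carrier R" using prime_chains_le_0 by blast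
  then show ?case by (intro exI[of _ 0] allI) auto
next
  case (Suc \<delta>)
  from Suc.prems show ?case
  proof (induction J rule: noetherian_induct)
    case (step J)

    interpret J: ideal J R by fact
    show ?case
    proof (cases "primeideal J R")
      case False
      show ?thesis
      proof (cases "J = carrier R")
        case True
        then show ?thesis by (intro exI[of _ 0] allI) auto
      next
        case ne: False
        then obtain a b where ab: "a \<in> carrier R" "b \<in> carrier R" "a \<otimes> b \<in> J" "a \<notin> J" "b \<notin> J"
          using J.primeidealCD[OF is_cring False] by auto
        \<comment> \<open>Both ideals are strictly larger than \<open>J\<close>: \<open>a\<close>
          lies in the first and \<open>b\<close> in the second.\<close>
        let ?I = "J <+>\<^bsub>R\<^esub> PIdl a" and ?K = "{r \<in> carrier R. a \<otimes> r \<in> J}"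
        have I: "ideal ?I R" by (intro add_ideals J.is_ideal cgenideal_ideal ab)
        have K: "ideal ?K R" using J.helper_max_prime[OF is_cring ab(1)] .
        have JI: "J \<subset> ?I"
          using ideal_add_principal[OF J.is_ideal ab(1)] ab(4) by blast
        have JK: "J \<subset> ?K"
        proof -
          have "a \<otimes> r \<in> J" if "r \<in> J" for r using J.I_l_closed[OF that ab(1)] .
          then have "J \<subseteq> ?K" by (intro subsetI CollectI conjI J.Icarr)
          moreover have "b \<in> ?K" using ab by auto
          ultimately show ?thesis using ab(5) by auto
        qed
        obtain C where C: "\<forall>e. \<exists>h. fgen e ?I h \<and> h * p ^ e \<le> C * (\<kappa> * p ^ Suc \<delta>) ^ e"
          using step.IH[OF I JI prime_chains_le_mono[OF step.prems psubset_imp_subset[OF JI]]] ..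
        obtain D where D: "\<forall>e. \<exists>h. fgen e ?K h \<and> h * p ^ e \<le> D * (\<kappa> * p ^ Suc \<delta>) ^ e"
          using step.IH[OF K JK prime_chains_le_mono[OF step.prems psubset_imp_subset[OF JK]]] ..
        show ?thesis
        proof (rule exI[of _ "C + D"], rule allI)
          fix e
          obtain h where h: "fgen e ?I h" "h * p ^ e \<le> C * (\<kappa> * p ^ Suc \<delta>) ^ e"
            using C[rule_format, of e] by (elim exE conjE)
          obtain k where k: "fgen e ?K k" "k * p ^ e \<le> D * (\<kappa> * p ^ Suc \<delta>) ^ e"
            using D[rule_format, of e] by (elim exE conjE)
          have "(h + k) * p ^ e \<le> (C + D) * (\<kappa> * p ^ Suc \<delta>) ^ e"
            unfolding add_mult_distrib using h(2) k(2) by (rule add_mono)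
          with fgen_split[OF J.is_ideal ab(1) h(1) k(1)]
          show "\<exists>h. fgen e J h \<and> h * p ^ e \<le> (C + D) * (\<kappa> * p ^ Suc \<delta>) ^ e"
            by blast
        qed
      qed
    next
      case prime: True
      show ?thesis
      proof (cases "J = \<mm>")
        case True
        show ?thesis
        \<comment> \<open>Over the residue field \<open>\<kappa> ^ e\<close> generators suffice, and
          the remaining factor \<open>p ^ e\<close> is absorbed by the exponent
          \<open>Suc \<delta>\<close>.\<close>
        proof (rule exI[of _ 1], rule allI, rule exI[of _ "\<kappa> ^ e" for e], rule conjI)
          fix e
          show "fgen e J (\<kappa> ^ e)" unfolding True using fgen_power[OF is_ideal \<kappa>] .
          have "p ^ e \<le> (p ^ Suc \<delta>) ^ e" using p_gt_1 by (intro power_mono) auto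
          then show "\<kappa> ^ e * p ^ e \<le> 1 * (\<kappa> * p ^ Suc \<delta>) ^ e"
            unfolding power_mult_distrib by simp
        qed
      next
        case False
        \<comment> \<open>Membership in \<open>\<mm>\<close> is what Nakayama's lemma requires,
          while \<open>x \<notin> J\<close> shortens the prime chains. The cost is one factor
          \<open>p ^ e\<close>, which raises \<open>\<delta>\<close> to
          \<open>Suc \<delta>\<close>.\<close>
        then obtain x where x: "x \<in> \<mm>" "x \<notin> J"
          using proper_ideal_subset[OF J.is_ideal] primeideal.I_notcarr[OF prime] by auto
        have xc: "x \<in> carrier R" using x Icarr by blast
        let ?I = "J <+>\<^bsub>R\<^esub> PIdl x"
        have I: "ideal ?I R" by (intro add_ideals J.is_ideal cgenideal_ideal xc)
        note JI = ideal_add_principal[OF J.is_ideal xc]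
        obtain C where C: "\<forall>e. \<exists>h. fgen e ?I h \<and> h * p ^ e \<le> C * (\<kappa> * p ^ \<delta>) ^ e"
          using Suc.IH[OF I prime_chains_le_add_principal[OF prime step.prems x(2) JI]] ..
        show ?thesis
        proof (rule exI[of _ C], rule allI)
          fix e
          obtain h where h: "fgen e ?I h" "h * p ^ e \<le> C * (\<kappa> * p ^ \<delta>) ^ e"
            using C[rule_format, of e] by (elim exE conjE)
          have "p ^ e * h * p ^ e \<le> p ^ e * (C * (\<kappa> * p ^ \<delta>) ^ e)"
            using h(2) by (simp add: mult.assoc)
          also have "\<dots> = C * (\<kappa> * p ^ Suc \<delta>) ^ e" by (simp add: power_mult_distrib)
          finally have "p ^ e * h * p ^ e \<le> C * (\<kappa> * p ^ Suc \<delta>) ^ e" .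
          with fgen_of_principal[OF J.is_ideal x(1) h(1)]
          show "\<exists>h. fgen e J h \<and> h * p ^ e \<le> C * (\<kappa> * p ^ Suc \<delta>) ^ e"
            by blast
        qed
      qed
    qed
  qed
qed

end

section \<open>Free summands and dual systems\<close>

context F_finite_local_ring
begin

definition fhoms :: "nat \<Rightarrow> ('a \<Rightarrow> 'a) set" where
  "fhoms e = module_hom R (frobenius_pushforward p R e) (self_module R)"

lemma fhoms_iff:
  "\<phi> \<in> fhoms e \<longleftrightarrow> (\<forall>x\<in>carrier R. \<phi> x \<in> carrier R)
     \<and> (\<forall>x\<in>carrier R. \<forall>y\<in>carrier R. \<phi> (x \<oplus> y) = \<phi> x \<oplus> \<phi> y)
     \<and> (\<forall>a\<in>carrier R. \<forall>x\<in>carrier R. \<phi> (frob e a \<otimes> x) = a \<otimes> \<phi> x)"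
  by (simp add: fhoms_def module_hom_def self_module_def Pi_iff)

lemma fhoms_closed: "\<phi> \<in> fhoms e \<Longrightarrow> x \<in> carrier R \<Longrightarrow> \<phi> x \<in> carrier R"
  and fhoms_add: "\<phi> \<in> fhoms e \<Longrightarrow> x \<in> carrier R \<Longrightarrow> y \<in> carrier R \<Longrightarrow> \<phi> (x \<oplus> y) = \<phi> x \<oplus> \<phi> y"
  and fhoms_smult: "\<phi> \<in> fhoms e \<Longrightarrow> a \<in> carrier R \<Longrightarrow> x \<in> carrier R \<Longrightarrow> \<phi> (frob e a \<otimes> x) = a \<otimes> \<phi> x"
  by (simp_all add: fhoms_iff)

lemma fhoms_zero: "\<phi> \<in> fhoms e \<Longrightarrow> \<phi> \<zero> = \<zero>"
  using fhoms_smult[of \<phi> e \<zero> \<zero>] fhoms_closed[of \<phi> e \<zero>] by simp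

lemma fhoms_minus: "\<phi> \<in> fhoms e \<Longrightarrow> x \<in> carrier R \<Longrightarrow> \<phi> (\<ominus> x) = \<ominus> \<phi> x"
  using fhoms_smult[of \<phi> e "\<ominus> \<one>" x] fhoms_closed[of \<phi> e x] by (simp add: frob_minus l_minus)

lemma fhoms_finsum:
  assumes \<phi>: "\<phi> \<in> fhoms e" and "finite A" "f \<in> A \<rightarrow> carrier R"
  shows "\<phi> (\<Oplus>i\<in>A. f i) = (\<Oplus>i\<in>A. \<phi> (f i))"
  using assms(2,3)
proof (induction A rule: finite_induct)
  case empty
  then show ?case using fhoms_zero[OF \<phi>] by simp
next
  case (insert i A)
  then have "f \<in> A \<rightarrow> carrier R" "f i \<in> carrier R" "(\<lambda>i. \<phi> (f i)) \<in> A \<rightarrow> carrier R"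
    "\<phi> (f i) \<in> carrier R"
    using fhoms_closed[OF \<phi>] by auto
  then show ?case using insert.hyps insert.IH fhoms_add[OF \<phi>] by simp
qed

lemma splitting_ideal_iff:
  "r \<in> splitting_ideal p R \<mm> e \<longleftrightarrow> r \<in> carrier R \<and> (\<forall>\<phi>\<in>fhoms e. \<phi> r \<in> \<mm>)"
  by (simp add: splitting_ideal_def fhoms_def)

lemma fhoms_scale:
  assumes \<phi>: "\<phi> \<in> fhoms e" and a: "a \<in> carrier R"
  shows "(\<lambda>x. \<phi> (a \<otimes> x)) \<in> fhoms e"
proof -
  have "\<phi> (a \<otimes> (frob e b \<otimes> x)) = b \<otimes> \<phi> (a \<otimes> x)" if "b \<in> carrier R" "x \<in> carrier R" for b x
    using fhoms_smult[OF \<phi> that(1), of "a \<otimes> x"] that a by (simp add: m_lcomm)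
  then show ?thesis using \<phi> a by (simp add: fhoms_iff r_distr)
qed

lemma ideal_splitting_ideal: "ideal (splitting_ideal p R \<mm> e) R"
proof (rule idealI)
  show "subgroup (splitting_ideal p R \<mm> e) (add_monoid R)"
  proof (rule add.subgroupI)
    have "\<zero> \<in> splitting_ideal p R \<mm> e" by (simp add: splitting_ideal_iff fhoms_zero)
    then show "splitting_ideal p R \<mm> e \<noteq> {}" by blast
  qed (auto simp: splitting_ideal_iff fhoms_add fhoms_minus)
next
  fix a x assume a: "a \<in> splitting_ideal p R \<mm> e" and x: "x \<in> carrier R"
  have "\<phi> (x \<otimes> a) \<in> \<mm>" if "\<phi> \<in> fhoms e" for \<phi>
    using fhoms_scale[OF that x] a by (auto simp: splitting_ideal_iff)
  then show "x \<otimes> a \<in> splitting_ideal p R \<mm> e" "a \<otimes> x \<in> splitting_ideal p R \<mm> e"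
    using a x by (auto simp: splitting_ideal_iff m_comm)
qed (rule ring_axioms)

text \<open>Linearity gives \<open>\<phi> (frob e s \<otimes> r) = s \<otimes> \<phi> r\<close>,
  which is in \<open>\<mm>\<close> for \<open>s \<in> \<mm>\<close>. So F^e_*(R/I_e) is a vector
  space over the residue field.\<close>

lemma annihilates_splitting_ideal: "annihilates e \<mm> (splitting_ideal p R \<mm> e)"
proof -
  have "frob e s \<otimes> r \<in> splitting_ideal p R \<mm> e" if s: "s \<in> \<mm>" and r: "r \<in> carrier R" for s r
    using s r Icarr[OF s] fhoms_closed
    by (auto simp: splitting_ideal_iff fhoms_smult intro!: I_r_closed)
  then show ?thesis
    by (auto simp: annihilates_def prime_mm intro: fsub_ideal[OF ideal_splitting_ideal])
qed

text \<open>A functional on F^(d+e)_*R composed with F^d is a functional on F^e_*R.\<close>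

lemma frob_mem_splitting_ideal:
  assumes "r \<in> splitting_ideal p R \<mm> e"
  shows "frob d r \<in> splitting_ideal p R \<mm> (d + e)"
proof -
  have r: "r \<in> carrier R" using assms by (simp add: splitting_ideal_iff)
  have "\<phi> (frob d r) \<in> \<mm>" if \<phi>: "\<phi> \<in> fhoms (d + e)" for \<phi>
  proof -
    have "(\<lambda>x. \<phi> (frob d x)) \<in> fhoms e"
      using \<phi> fhoms_smult[OF \<phi>] by (simp add: fhoms_iff frob_add frob_mult)
    then show ?thesis using assms by (auto simp: splitting_ideal_iff)
  qed
  then show ?thesis using r by (simp add: splitting_ideal_iff)
qed

text \<open>Some functional takes a unit value at \<open>r\<close>, and rescaling it gives the value
  1; such an \<open>r\<close> spans a free summand of rank one.\<close>

lemma notin_splitting_ideal: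
  assumes "r \<in> carrier R" "r \<notin> splitting_ideal p R \<mm> e"
  obtains \<phi> where "\<phi> \<in> fhoms e" "\<phi> r = \<one>"
proof -
  obtain \<phi> where \<phi>: "\<phi> \<in> fhoms e" "\<phi> r \<notin> \<mm>" using assms by (auto simp: splitting_ideal_iff)
  obtain b where b: "b \<in> carrier R" "\<phi> r \<otimes> b = \<one>"
    using unit_of_notin[OF fhoms_closed[OF \<phi>(1) assms(1)] \<phi>(2)] .
  have "\<phi> (frob e b \<otimes> r) = \<one>"
    using fhoms_smult[OF \<phi>(1) b(1) assms(1)] b fhoms_closed[OF \<phi>(1) assms(1)] by (simp add: m_comm)
  then show thesis using that fhoms_scale[OF \<phi>(1), of "frob e b"] b by blast
qed

text \<open>A free direct summand of rank \<open>n\<close> amounts to elements and functionals in duality.\<close>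

definition dual_system :: "nat \<Rightarrow> nat \<Rightarrow> (nat \<Rightarrow> 'a) \<Rightarrow> (nat \<Rightarrow> 'a \<Rightarrow> 'a) \<Rightarrow> bool" where
  "dual_system e n x \<phi> \<longleftrightarrow> (\<forall>i<n. x i \<in> carrier R \<and> \<phi> i \<in> fhoms e)
     \<and> (\<forall>i<n. \<forall>j<n. \<phi> i (x j) = (if i = j then \<one> else \<zero>))"

definition flincomb :: "nat \<Rightarrow> nat \<Rightarrow> (nat \<Rightarrow> 'a) \<Rightarrow> (nat \<Rightarrow> 'a) \<Rightarrow> 'a" where
  "flincomb e n x v = (\<Oplus>i\<in>{..<n}. frob e (v i) \<otimes> x i)"

lemma flincomb_mem:
  assumes B: "fsub e B" and x: "x ` {..<n} \<subseteq> B" and v: "v \<in> {..<n} \<rightarrow> carrier R"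
  shows "flincomb e n x v \<in> B"
  using x v
proof (induction n)
  case 0
  then show ?case using fsub_zero[OF B] by (simp add: flincomb_def)
next
  case (Suc n)
  have c: "x i \<in> carrier R" if "i < Suc n" for i
    using that Suc.prems fsub_carrier[OF B] by auto
  have "flincomb e (Suc n) x v = frob e (v n) \<otimes> x n \<oplus> flincomb e n x v"
    unfolding flincomb_def lessThan_Suc using Suc.prems c by (intro finsum_insert) (auto simp: Pi_iff)
  moreover have "flincomb e n x v \<in> B" using Suc by (simp add: Pi_iff image_subset_iff)
  moreover have "frob e (v n) \<otimes> x n \<in> B" using Suc.prems by (intro fsub_smult[OF B]) auto
  ultimately show ?case using fsub_add[OF B] by simp
qed

lemma flincomb_closed:
  "x ` {..<n} \<subseteq> carrier R \<Longrightarrow> v \<in> {..<n} \<rightarrow> carrier R \<Longrightarrow> flincomb e n x v \<in> carrier R"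
  using flincomb_mem[OF fsub_ideal[OF oneideal]] .

lemma flincomb_add:
  assumes x: "x ` {..<n} \<subseteq> carrier R" and v: "v \<in> {..<n} \<rightarrow> carrier R" "w \<in> {..<n} \<rightarrow> carrier R"
  shows "flincomb e n x (\<lambda>i\<in>{..<n}. v i \<oplus> w i) = flincomb e n x v \<oplus> flincomb e n x w"
proof -
  have "flincomb e n x (\<lambda>i\<in>{..<n}. v i \<oplus> w i)
      = (\<Oplus>i\<in>{..<n}. frob e (v i) \<otimes> x i \<oplus> frob e (w i) \<otimes> x i)"
    unfolding flincomb_def using x v
    by (intro finsum_cong') (auto simp: frob_add l_distr Pi_iff image_subset_iff)
  also have "\<dots> = flincomb e n x v \<oplus> flincomb e n x w"
    unfolding flincomb_def using x v by (intro finsum_addf) (auto simp: Pi_iff image_subset_iff)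
  finally show ?thesis .
qed

lemma flincomb_smult:
  assumes x: "x ` {..<n} \<subseteq> carrier R" and v: "v \<in> {..<n} \<rightarrow> carrier R" and a: "a \<in> carrier R"
  shows "flincomb e n x (\<lambda>i\<in>{..<n}. a \<otimes> v i) = frob e a \<otimes> flincomb e n x v"
proof -
  have "flincomb e n x (\<lambda>i\<in>{..<n}. a \<otimes> v i) = (\<Oplus>i\<in>{..<n}. frob e a \<otimes> (frob e (v i) \<otimes> x i))"
    unfolding flincomb_def using x v a
    by (intro finsum_cong') (auto simp: frob_mult m_assoc Pi_iff image_subset_iff)
  also have "\<dots> = frob e a \<otimes> flincomb e n x v"
    unfolding flincomb_def using x v a
    by (intro finsum_rdistr[symmetric]) (auto simp: Pi_iff image_subset_iff)
  finally show ?thesis .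
qed

context
  fixes e n x \<phi> assumes dual: "dual_system e n x \<phi>"
begin

lemma dual_x: "i < n \<Longrightarrow> x i \<in> carrier R" and dual_hom: "i < n \<Longrightarrow> \<phi> i \<in> fhoms e"
  and dual_eq: "i < n \<Longrightarrow> j < n \<Longrightarrow> \<phi> i (x j) = (if i = j then \<one> else \<zero>)"
  using dual by (auto simp: dual_system_def)

lemma dual_x': "x ` {..<n} \<subseteq> carrier R" using dual_x by auto

lemma dual_flincomb:
  assumes j: "j < n" and v: "v \<in> {..<n} \<rightarrow> carrier R"
  shows "\<phi> j (flincomb e n x v) = v j"
proof -
  have "\<phi> j (flincomb e n x v) = (\<Oplus>i\<in>{..<n}. \<phi> j (frob e (v i) \<otimes> x i))"
    unfolding flincomb_def using v dual_x by (intro fhoms_finsum[OF dual_hom[OF j]]) (auto simp: Pi_iff)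
  also have "\<dots> = (\<Oplus>i\<in>{..<n}. if j = i then v i else \<zero>)"
    using v dual_x j
    by (intro finsum_cong') (auto simp: Pi_iff fhoms_smult[OF dual_hom[OF j]] dual_eq)
  also have "\<dots> = v j" using v j by (intro finsum_singleton) auto
  finally show ?thesis .
qed

text \<open>The projection onto the common kernel of the functionals along the span of the
  \<open>x i\<close>.\<close>

definition dual_proj :: "'a \<Rightarrow> 'a" where
  "dual_proj r = r \<ominus> flincomb e n x (\<lambda>i. \<phi> i r)"

lemma dual_coords: "r \<in> carrier R \<Longrightarrow> (\<lambda>i. \<phi> i r) \<in> {..<n} \<rightarrow> carrier R"
  using dual_hom fhoms_closed by auto

lemma dual_proj_closed: "r \<in> carrier R \<Longrightarrow> dual_proj r \<in> carrier R"
  unfolding dual_proj_def using flincomb_closed[OF dual_x' dual_coords] by simp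

lemma dual_proj_decomp:
  "r \<in> carrier R \<Longrightarrow> r = flincomb e n x (\<lambda>i. \<phi> i r) \<oplus> dual_proj r"
  unfolding dual_proj_def using flincomb_closed[OF dual_x' dual_coords]
  by (simp add: a_minus_def a_lcomm r_neg)

lemma flincomb_cong:
  assumes "\<And>i. i < n \<Longrightarrow> v i = w i" "w \<in> {..<n} \<rightarrow> carrier R"
  shows "flincomb e n x v = flincomb e n x w"
  unfolding flincomb_def using assms dual_x by (intro finsum_cong') (auto simp: Pi_iff)

lemma dual_proj_add:
  assumes r: "r \<in> carrier R" and s: "s \<in> carrier R"
  shows "dual_proj (r \<oplus> s) = dual_proj r \<oplus> dual_proj s"
proof -
  have "flincomb e n x (\<lambda>i. \<phi> i (r \<oplus> s)) = flincomb e n x (\<lambda>i\<in>{..<n}. \<phi> i r \<oplus> \<phi> i s)"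
    using r s fhoms_add[OF dual_hom] fhoms_closed[OF dual_hom] by (intro flincomb_cong) auto
  then show ?thesis
    using r s flincomb_closed[OF dual_x' dual_coords[OF r]] flincomb_closed[OF dual_x' dual_coords[OF s]]
    by (simp add: dual_proj_def flincomb_add[OF dual_x' dual_coords dual_coords] a_minus_def
        minus_add a_ac)
qed

lemma dual_proj_smult:
  assumes r: "r \<in> carrier R" and a: "a \<in> carrier R"
  shows "dual_proj (frob e a \<otimes> r) = frob e a \<otimes> dual_proj r"
proof -
  have "flincomb e n x (\<lambda>i. \<phi> i (frob e a \<otimes> r)) = flincomb e n x (\<lambda>i\<in>{..<n}. a \<otimes> \<phi> i r)"
    using r a fhoms_smult[OF dual_hom] fhoms_closed[OF dual_hom] by (intro flincomb_cong) auto
  then show ?thesis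
    using r a flincomb_closed[OF dual_x' dual_coords[OF r]]
    by (simp add: dual_proj_def flincomb_smult[OF dual_x' dual_coords] a_minus_def r_distr r_minus)
qed

lemma dual_hom_proj:
  assumes r: "r \<in> carrier R" and j: "j < n"
  shows "\<phi> j (dual_proj r) = \<zero>"
  using r j fhoms_closed[OF dual_hom[OF j] r] flincomb_closed[OF dual_x' dual_coords[OF r]]
  by (simp add: dual_proj_def a_minus_def fhoms_add[OF dual_hom[OF j]] fhoms_minus[OF dual_hom[OF j]]
      dual_flincomb[OF j dual_coords[OF r]] r_neg)

lemma flincomb_zero: "flincomb e n x (\<lambda>_. \<zero>) = \<zero>"
  unfolding flincomb_def using dual_x by (intro add.finprod_one_eqI) auto

lemma dual_proj_fixed:
  assumes "r \<in> carrier R" "\<And>i. i < n \<Longrightarrow> \<phi> i r = \<zero>"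
  shows "dual_proj r = r"
  using assms flincomb_cong[of "\<lambda>i. \<phi> i r" "\<lambda>_. \<zero>"]
  by (simp add: dual_proj_def flincomb_zero a_minus_def)

lemma dual_proj_x:
  assumes j: "j < n"
  shows "dual_proj (x j) = \<zero>"
proof -
  have "flincomb e n x (\<lambda>i. \<phi> i (x j)) = (\<Oplus>i\<in>{..<n}. if j = i then x i else \<zero>)"
    unfolding flincomb_def using dual_x j by (intro finsum_cong') (auto simp: dual_eq)
  also have "\<dots> = x j" using dual_x j by (intro finsum_singleton) auto
  finally show ?thesis using dual_x[OF j] by (simp add: dual_proj_def a_minus_def r_neg)
qed

text \<open>The elements of a dual system are independent modulo I_e over the residue field:
  \<open>\<phi> k\<close> kills the earlier elements, maps I_e into \<open>\<mm>\<close> and sends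
  \<open>frob e a \<otimes> x k\<close> to \<open>a\<close>.\<close>

lemma dual_length_le:
  assumes b: "fgen e (splitting_ideal p R \<mm> e) b"
  shows "n \<le> b"
proof -
  let ?I = "splitting_ideal p R \<mm> e"
  \<comment> \<open>The reversal places \<open>x k\<close> before the elements with smaller index,
    against which \<open>indep_list\<close> tests it.\<close>
  have "indep_list (fcl e \<mm> ?I) (map x (rev [0..<k]))" if "k \<le> n" for k
    using that
  proof (induction k)
    case 0
    then show ?case by (simp add: indep_list.Nil)
  next
    case (Suc k)
    then have k: "k < n" by simp
    note \<phi> = dual_hom[OF k]
    have "x k \<notin> fcl e \<mm> ?I (x ` {..<k})"
    proof
      assume "x k \<in> fcl e \<mm> ?I (x ` {..<k})"
      then obtain a where a: "a \<in> carrier R" "a \<notin> \<mm>" "frob e a \<otimes> x k \<in> fspan e (x ` {..<k}) ?I"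
        by (auto simp: fcl_def)
      let ?D = "{r \<in> carrier R. \<phi> k r \<in> \<mm>}"
      have "fspan e (x ` {..<k}) ?I \<subseteq> ?D"
      proof (rule fspan_minimal)
        show "fsub e ?D"
          using fhoms_zero[OF \<phi>] fhoms_add[OF \<phi>] fhoms_smult[OF \<phi>] I_l_closed by (auto simp: fsub_def)
        show "?I \<subseteq> ?D" using \<phi> by (auto simp: splitting_ideal_iff)
        show "x ` {..<k} \<subseteq> ?D" using dual_x dual_eq k by auto
      qed
      then have "\<phi> k (frob e a \<otimes> x k) \<in> \<mm>" using a(3) by blast
      then show False using a fhoms_smult[OF \<phi> a(1) dual_x[OF k]] dual_eq[OF k k] by simp
    qed
    moreover have "set (map x (rev [0..<k])) = x ` {..<k}" by auto
    ultimately show ?case using Suc by (auto simp: indep_list_Cons_iff)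
  qed
  from this[of n] have "length (map x (rev [0..<n])) \<le> b"
    using dual_x by (intro indep_length_le[OF annihilates_splitting_ideal _ _ b]) auto
  then show ?thesis by simp
qed

text \<open>The old functionals vanish on \<open>dual_proj r\<close>, and composing the new one with
  \<open>dual_proj\<close> makes it vanish on the old elements.\<close>

lemma dual_extend:
  assumes r: "r \<in> carrier R" and nr: "dual_proj r \<notin> splitting_ideal p R \<mm> e"
  obtains y \<psi> where "dual_system e (Suc n) y \<psi>"
proof -
  obtain \<psi> where \<psi>: "\<psi> \<in> fhoms e" "\<psi> (dual_proj r) = \<one>"
    using notin_splitting_ideal[OF dual_proj_closed[OF r] nr] .
  let ?y = "\<lambda>i. if i < n then x i else dual_proj r"
  let ?\<psi> = "\<lambda>i. if i < n then \<phi> i else (\<lambda>s. \<psi> (dual_proj s))"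
  have h: "(\<lambda>s. \<psi> (dual_proj s)) \<in> fhoms e"
    using fhoms_closed[OF \<psi>(1)] fhoms_add[OF \<psi>(1)] fhoms_smult[OF \<psi>(1)]
      dual_proj_closed dual_proj_add dual_proj_smult
    by (simp add: fhoms_iff)
  have "\<psi> (dual_proj (dual_proj r)) = \<one>"
    using dual_proj_fixed[OF dual_proj_closed[OF r]] dual_hom_proj[OF r] \<psi>(2) by simp
  then have "dual_system e (Suc n) ?y ?\<psi>"
    unfolding dual_system_def
    using dual_x dual_hom dual_eq h dual_hom_proj[OF r] dual_proj_closed[OF r] fhoms_zero[OF \<psi>(1)]
    by (auto simp: less_Suc_eq dual_proj_x)
  then show thesis by (rule that)
qed

lemma dual_summand: "has_free_summand R (frobenius_pushforward p R e) n"
  unfolding has_free_summand_def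
proof (intro exI conjI)
  let ?C = "{..<n} \<rightarrow>\<^sub>E carrier R"
  let ?N = "flincomb e n x ` ?C"
  let ?L = "{r \<in> carrier R. \<forall>i<n. \<phi> i r = \<zero>}"
  have C: "v \<in> {..<n} \<rightarrow> carrier R" if "v \<in> ?C" for v using that by (auto simp: PiE_def)
  have 0: "flincomb e n x (\<lambda>i\<in>{..<n}. \<zero>) = \<zero>"
    using flincomb_cong[of "\<lambda>i\<in>{..<n}. \<zero>" "\<lambda>_. \<zero>"] flincomb_zero by simp
  have sm: "(\<lambda>i\<in>{..<n}. a \<otimes> v i) \<in> ?C" if "a \<in> carrier R" "v \<in> ?C" for a v
    using that C[of v] by (auto simp: Pi_iff)
  have ad: "(\<lambda>i\<in>{..<n}. v i \<oplus> w i) \<in> ?C" if "v \<in> ?C" "w \<in> ?C" for v w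
    using C[of v] C[of w] that by (auto simp: Pi_iff)
  have fN: "fsub e ?N"
    unfolding fsub_def
  proof (intro conjI ballI)
    show "?N \<subseteq> carrier R" using flincomb_closed[OF dual_x'] C by auto
    have "(\<lambda>i\<in>{..<n}. \<zero>) \<in> ?C" by auto
    then have "flincomb e n x (\<lambda>i\<in>{..<n}. \<zero>) \<in> ?N" by (rule imageI)
    then show "\<zero> \<in> ?N" unfolding 0 .
    fix r s assume "r \<in> ?N" "s \<in> ?N"
    then obtain v w where v: "v \<in> ?C" and w: "w \<in> ?C"
      and rs: "r = flincomb e n x v" "s = flincomb e n x w" by auto
    show "r \<oplus> s \<in> ?N"
      unfolding rs flincomb_add[OF dual_x' C[OF v] C[OF w], symmetric] using ad[OF v w] by (rule imageI)
  next
    fix a r assume a: "a \<in> carrier R" and "r \<in> ?N"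
    then obtain v where v: "v \<in> ?C" and r: "r = flincomb e n x v" by auto
    show "frob e a \<otimes> r \<in> ?N"
      unfolding r flincomb_smult[OF dual_x' C[OF v] a, symmetric] using sm[OF a v] by (rule imageI)
  qed
  then show "submodule ?N R (frobenius_pushforward p R e)" by (simp add: submodule_iff_fsub)
  have "fsub e ?L"
    using fhoms_zero[OF dual_hom] fhoms_add[OF dual_hom] fhoms_smult[OF dual_hom]
    by (auto simp: fsub_def)
  then show "submodule ?L R (frobenius_pushforward p R e)" by (simp add: submodule_iff_fsub)
  show "?N \<inter> ?L = {\<zero>\<^bsub>frobenius_pushforward p R e\<^esub>}"
  proof
    show "?N \<inter> ?L \<subseteq> {\<zero>\<^bsub>frobenius_pushforward p R e\<^esub>}"
    proof
      fix r assume r: "r \<in> ?N \<inter> ?L"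
      then obtain v where v: "v \<in> ?C" "r = flincomb e n x v" by auto
      have "v i = \<zero>" if "i < n" for i
        using r v that dual_flincomb[OF that C[OF v(1)]] by auto
      then have "flincomb e n x v = \<zero>"
        using flincomb_cong[of v "\<lambda>_. \<zero>"] flincomb_zero by simp
      then show "r \<in> {\<zero>\<^bsub>frobenius_pushforward p R e\<^esub>}" using v by simp
    qed
    show "{\<zero>\<^bsub>frobenius_pushforward p R e\<^esub>} \<subseteq> ?N \<inter> ?L"
      using fsub_zero[OF fN] fsub_zero[OF \<open>fsub e ?L\<close>] by simp
  qed
  have "carrier R \<subseteq> ?N <+>\<^bsub>R\<^esub> ?L"
  proof
    fix r assume r: "r \<in> carrier R"
    let ?v = "\<lambda>i\<in>{..<n}. \<phi> i r"
    have v: "?v \<in> ?C" using dual_coords[OF r] by auto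
    have "flincomb e n x (\<lambda>i. \<phi> i r) = flincomb e n x ?v"
      using C[OF v] by (intro flincomb_cong) auto
    then have "r = flincomb e n x ?v \<oplus> dual_proj r" using dual_proj_decomp[OF r] by simp
    moreover have "dual_proj r \<in> ?L" using dual_proj_closed[OF r] dual_hom_proj[OF r] by simp
    ultimately show "r \<in> ?N <+>\<^bsub>R\<^esub> ?L" using v unfolding set_add_def' by blast
  qed
  moreover have "?N <+>\<^bsub>R\<^esub> ?L \<subseteq> carrier R"
    using fsub_carrier[OF fN] by (auto simp: set_add_def')
  ultimately show "?N <+>\<^bsub>frobenius_pushforward p R e\<^esub> ?L = carrier (frobenius_pushforward p R e)"
    by (simp add: set_add_def')
  show "module_iso R (free_module R n) (frobenius_pushforward p R e\<lparr>carrier := ?N\<rparr>)"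
    unfolding module_iso_def
  proof (intro bexI)
    show "flincomb e n x \<in> module_hom R (free_module R n) (frobenius_pushforward p R e\<lparr>carrier := ?N\<rparr>)"
      using C flincomb_add[OF dual_x'] flincomb_smult[OF dual_x']
      by (auto simp: module_hom_def free_module_def)
    have "inj_on (flincomb e n x) ?C"
    proof (rule inj_onI)
      fix v w assume vw: "v \<in> ?C" "w \<in> ?C" "flincomb e n x v = flincomb e n x w"
      show "v = w"
      proof (rule PiE_ext[OF vw(1,2)])
        fix i assume "i \<in> {..<n}"
        then show "v i = w i"
          using dual_flincomb[of i v] dual_flincomb[of i w] C vw by simp
      qed
    qed
    then show "bij_betw (flincomb e n x) (carrier (free_module R n))
        (carrier (frobenius_pushforward p R e\<lparr>carrier := ?N\<rparr>))"
      by (simp add: free_module_def bij_betw_def)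
  qed
qed

end

lemma summand_dual:
  assumes "has_free_summand R (frobenius_pushforward p R e) n"
  obtains x \<phi> where "dual_system e n x \<phi>"
proof -
  let ?C = "{..<n} \<rightarrow>\<^sub>E carrier R"
  obtain N L where NL: "fsub e N" "fsub e L" "N \<inter> L = {\<zero>}" "N <+>\<^bsub>R\<^esub> L = carrier R"
    and iso: "module_iso R (free_module R n) (frobenius_pushforward p R e\<lparr>carrier := N\<rparr>)"
    using assms unfolding has_free_summand_def by (auto simp: submodule_iff_fsub set_add_def')
  obtain \<psi> where hom: "\<psi> \<in> module_hom R (free_module R n) (frobenius_pushforward p R e\<lparr>carrier := N\<rparr>)"
    and bij: "bij_betw \<psi> ?C N"
    using iso unfolding module_iso_def by (auto simp: free_module_def)
  have \<psi>_add: "\<psi> (\<lambda>i\<in>{..<n}. v i \<oplus> w i) = \<psi> v \<oplus> \<psi> w" if "v \<in> ?C" "w \<in> ?C" for v w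
    using hom that by (simp add: module_hom_def free_module_def)
  have \<psi>_smult: "\<psi> (\<lambda>i\<in>{..<n}. a \<otimes> v i) = frob e a \<otimes> \<psi> v" if "a \<in> carrier R" "v \<in> ?C" for a v
    using hom that by (simp add: module_hom_def free_module_def)
  define g where "g = inv_into ?C \<psi>"
  have g_mem: "g u \<in> ?C" and \<psi>_g: "\<psi> (g u) = u" if "u \<in> N" for u
    using bij that inv_into_into[of u \<psi> ?C] f_inv_into_f[of u \<psi> ?C]
    unfolding g_def bij_betw_def by auto
  have g_\<psi>: "g (\<psi> v) = v" if "v \<in> ?C" for v
    using bij that unfolding g_def bij_betw_def by (simp add: inv_into_f_f)
  have vc: "v i \<in> carrier R" if "v \<in> ?C" "i < n" for v i using that by auto
  have ad: "(\<lambda>i\<in>{..<n}. v i \<oplus> w i) \<in> ?C" if "v \<in> ?C" "w \<in> ?C" for v w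
    using vc that by auto
  have sm: "(\<lambda>i\<in>{..<n}. a \<otimes> v i) \<in> ?C" if "a \<in> carrier R" "v \<in> ?C" for a v
    using vc that by auto
  have g_add: "g (u \<oplus> u') = (\<lambda>i\<in>{..<n}. g u i \<oplus> g u' i)" if "u \<in> N" "u' \<in> N" for u u'
    using g_\<psi>[OF ad[OF g_mem g_mem]] that \<psi>_add[OF g_mem g_mem] \<psi>_g by simp
  have g_smult: "g (frob e a \<otimes> u) = (\<lambda>i\<in>{..<n}. a \<otimes> g u i)" if "u \<in> N" "a \<in> carrier R" for u a
    using g_\<psi>[OF sm[OF _ g_mem]] that \<psi>_smult[OF _ g_mem] \<psi>_g by simp
  have Nc: "u \<in> carrier R" if "u \<in> N" for u using fsub_carrier[OF NL(1) that] .
  have Lc: "u \<in> carrier R" if "u \<in> L" for u using fsub_carrier[OF NL(2) that] .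
  \<comment> \<open>The projection onto \<open>N\<close> along \<open>L\<close>; \<open>THE\<close>
    is justified by the trivial intersection. Its coordinates under \<open>g\<close> are the dual
    functionals.\<close>
  define pr where "pr r = (THE u. u \<in> N \<and> (\<exists>l\<in>L. r = u \<oplus> l))" for r
  have pr_eq: "pr (u \<oplus> l) = u" if u: "u \<in> N" and l: "l \<in> L" for u l
    unfolding pr_def
  proof (rule the_equality)
    show "u \<in> N \<and> (\<exists>l'\<in>L. u \<oplus> l = u \<oplus> l')" using u l by blast
    fix u' assume "u' \<in> N \<and> (\<exists>l'\<in>L. u \<oplus> l = u' \<oplus> l')"
    then obtain l' where u': "u' \<in> N" and l': "l' \<in> L" and eq: "u \<oplus> l = u' \<oplus> l'" by blast
    note c = Nc[OF u] Nc[OF u'] Lc[OF l] Lc[OF l']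
    have "u' \<ominus> u = \<ominus> u \<oplus> (u' \<oplus> l') \<ominus> l'"
      using c by (simp add: a_minus_def a_assoc r_neg a_comm[of u' "\<ominus> u"])
    also have "\<dots> = l \<ominus> l'" unfolding eq[symmetric] using c by (simp add: r_neg1)
    finally have "u' \<ominus> u = l \<ominus> l'" .
    moreover have "u' \<ominus> u \<in> N" using fsub_diff[OF NL(1) u' u] .
    moreover have "l \<ominus> l' \<in> L" using fsub_diff[OF NL(2) l l'] .
    ultimately have "u' \<ominus> u \<in> N \<inter> L" by simp
    then have "u' \<ominus> u = \<zero>" using NL(3) by blast
    then show "u' = u" using c by simp
  qed
  have ex: "\<exists>u\<in>N. \<exists>l\<in>L. r = u \<oplus> l" if "r \<in> carrier R" for r
    using that unfolding NL(4)[symmetric] set_add_def' by blast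
  have pr_mem: "pr r \<in> N" if "r \<in> carrier R" for r
    using ex[OF that] pr_eq by auto
  have pr_add: "pr (r \<oplus> s) = pr r \<oplus> pr s" if r: "r \<in> carrier R" and s: "s \<in> carrier R" for r s
  proof -
    obtain u l where u: "u \<in> N" "l \<in> L" "r = u \<oplus> l" using ex[OF r] by blast
    obtain u' l' where u': "u' \<in> N" "l' \<in> L" "s = u' \<oplus> l'" using ex[OF s] by blast
    have "r \<oplus> s = (u \<oplus> u') \<oplus> (l \<oplus> l')" using u u' Nc Lc by (simp add: a_ac)
    then show ?thesis
      using u u' pr_eq fsub_add[OF NL(1) u(1) u'(1)] fsub_add[OF NL(2) u(2) u'(2)] by simp
  qed
  have pr_smult: "pr (frob e a \<otimes> r) = frob e a \<otimes> pr r" if r: "r \<in> carrier R" and a: "a \<in> carrier R" for a r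
  proof -
    obtain u l where u: "u \<in> N" "l \<in> L" "r = u \<oplus> l" using ex[OF r] by blast
    have "frob e a \<otimes> r = frob e a \<otimes> u \<oplus> frob e a \<otimes> l" using u Nc Lc a by (simp add: r_distr)
    then show ?thesis
      using u pr_eq fsub_smult[OF NL(1) a u(1)] fsub_smult[OF NL(2) a u(2)] by simp
  qed
  \<comment> \<open>The standard basis vectors of the free module, whose images under
    \<open>\<psi>\<close> are the elements of the dual system.\<close>
  define b where "b j = (\<lambda>i\<in>{..<n}. if i = j then \<one> else \<zero>)" for j
  have b: "b j \<in> ?C" for j unfolding b_def by auto
  have \<psi>N: "\<psi> v \<in> N" if "v \<in> ?C" for v using bij that unfolding bij_betw_def by auto
  have pr_\<psi>: "pr (\<psi> (b j)) = \<psi> (b j)" for j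
    using pr_eq[OF \<psi>N[OF b] fsub_zero[OF NL(2)]] Nc[OF \<psi>N[OF b]] by simp
  have "(\<lambda>r. g (pr r) i) \<in> fhoms e" if i: "i < n" for i
    unfolding fhoms_iff
    using i vc[OF g_mem[OF pr_mem] i] pr_add pr_smult g_add[OF pr_mem pr_mem] g_smult[OF pr_mem]
    by simp
  moreover have "g (pr (\<psi> (b j))) i = (if i = j then \<one> else \<zero>)" if "i < n" for i j
    using that unfolding pr_\<psi> g_\<psi>[OF b] by (simp add: b_def)
  ultimately have "dual_system e n (\<lambda>j. \<psi> (b j)) (\<lambda>i r. g (pr r) i)"
    unfolding dual_system_def using Nc[OF \<psi>N[OF b]] by auto
  then show thesis by (rule that)
qed

section \<open>Splitting numbers as generator numbers\<close>

lemma fgen_mono_base: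
  assumes "fgen e B n" "B \<subseteq> D" "fsub e D"
  shows "fgen e D n"
proof -
  obtain S where S: "finite S" "S \<subseteq> carrier R" "card S \<le> n" "fspan e S B = carrier R"
    using assms(1) unfolding fgen_def by blast
  then show ?thesis
    using fspan_mono[OF subset_refl assms(2), of e S] by (intro fgenI[OF assms(3) S(1-3)]) simp
qed

text \<open>\<open>Max\<close> is meaningful only on a finite nonempty set. Ranks are bounded
  through F-finiteness, and the empty dual system shows that rank 0 occurs.\<close>

lemma splitting_number_is_Max:
  "finite {n. has_free_summand R (frobenius_pushforward p R e) n}"
  "{n. has_free_summand R (frobenius_pushforward p R e) n} \<noteq> {}"
proof -
  obtain N where "fgen e {\<zero>} N" by (rule fgen_finite)
  moreover have "{\<zero>} \<subseteq> splitting_ideal p R \<mm> e"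
    using fsub_zero[OF fsub_ideal[OF ideal_splitting_ideal]] by simp
  ultimately have N: "fgen e (splitting_ideal p R \<mm> e) N"
    by (rule fgen_mono_base[OF _ _ fsub_ideal[OF ideal_splitting_ideal]])
  have "n \<le> N" if n: "has_free_summand R (frobenius_pushforward p R e) n" for n
  proof -
    obtain x \<phi> where "dual_system e n x \<phi>" using n by (rule summand_dual)
    then show ?thesis using N by (rule dual_length_le)
  qed
  then show "finite {n. has_free_summand R (frobenius_pushforward p R e) n}"
    unfolding finite_nat_set_iff_bounded_le by blast
  have "dual_system e 0 (\<lambda>_. \<zero>) (\<lambda>_ _. \<zero>)" by (simp add: dual_system_def)
  from dual_summand[OF this]
  show "{n. has_free_summand R (frobenius_pushforward p R e) n} \<noteq> {}" by auto
qed

lemma splitting_number_dual: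
  obtains x \<phi> where "dual_system e (splitting_number p R e) x \<phi>"
proof -
  have "has_free_summand R (frobenius_pushforward p R e) (splitting_number p R e)"
    using Max_in[OF splitting_number_is_Max, of e] unfolding splitting_number_def by simp
  then show thesis using that by (rule summand_dual)
qed

lemma dual_le_splitting_number:
  assumes "dual_system e n x \<phi>"
  shows "n \<le> splitting_number p R e"
  unfolding splitting_number_def
  using Max_ge[OF splitting_number_is_Max(1)] dual_summand[OF assms] by blast

lemma splitting_number_le:
  assumes "fgen e (splitting_ideal p R \<mm> e) b"
  shows "splitting_number p R e \<le> b"
proof -
  obtain x \<phi> where "dual_system e (splitting_number p R e) x \<phi>" by (rule splitting_number_dual)
  then show ?thesis using assms by (rule dual_length_le)
qed

text \<open>A dual system of maximal rank cannot be extended, so the part of \<open>r\<close> left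
  over by its projection lies in I_e. With \<open>splitting_number_le\<close> this identifies a_e as
  the minimal number of generators.\<close>

lemma fgen_splitting_number:
  "fgen e (splitting_ideal p R \<mm> e) (splitting_number p R e)"
proof -
  let ?n = "splitting_number p R e" and ?I = "splitting_ideal p R \<mm> e"
  obtain x \<phi> where d: "dual_system e ?n x \<phi>" by (rule splitting_number_dual)
  have xc: "x ` {..<?n} \<subseteq> carrier R" by (rule dual_x'[OF d])
  note F = fsub_fspan[OF fsub_ideal[OF ideal_splitting_ideal] xc]
  have "r \<in> fspan e (x ` {..<?n}) ?I" if r: "r \<in> carrier R" for r
  proof -
    have "dual_proj e ?n x \<phi> r \<in> ?I"
    proof (rule ccontr)
      assume "dual_proj e ?n x \<phi> r \<notin> ?I"
      then obtain y \<psi> where "dual_system e (Suc ?n) y \<psi>" by (rule dual_extend[OF d r])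
      then show False using dual_le_splitting_number by fastforce
    qed
    moreover have "flincomb e ?n x (\<lambda>i. \<phi> i r) \<in> fspan e (x ` {..<?n}) ?I"
    proof (rule flincomb_mem[OF F _ dual_coords[OF d r]])
      show "x ` {..<?n} \<subseteq> fspan e (x ` {..<?n}) ?I"
        using xc by (blast intro: fspan_mem)
    qed
    ultimately show ?thesis
      by (subst dual_proj_decomp[OF d r]) (rule fspan.add, assumption, rule fspan.base)
  qed
  moreover have "card (x ` {..<?n}) \<le> ?n" using card_image_le[of "{..<?n}" x] by simp
  ultimately show ?thesis using xc by (intro fgenI[OF fsub_ideal[OF ideal_splitting_ideal]]) auto
qed

section \<open>The splitting prime\<close>

lemma splitting_prime_subset: "e \<ge> 1 \<Longrightarrow> splitting_prime p R \<mm> \<subseteq> splitting_ideal p R \<mm> e"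
  by (auto simp: splitting_prime_def)

lemma ideal_splitting_prime: "ideal (splitting_prime p R \<mm>) R"
  unfolding splitting_prime_def by (rule i_Intersect) (auto intro: ideal_splitting_ideal)

text \<open>If \<open>\<phi> a = \<one>\<close> and \<open>\<psi> b = \<one>\<close>, the composite
  functional sends \<open>frob c b \<otimes> a\<close> to
  \<open>\<psi> (b \<otimes> \<phi> a) = \<one>\<close>. Yet this element is a multiple of
  \<open>a \<otimes> b\<close>, so it would lie in I_(c+d).\<close>

lemma primeideal_splitting_prime:
  assumes "splitting_prime p R \<mm> \<noteq> carrier R"
  shows "primeideal (splitting_prime p R \<mm>) R"
proof (rule primeidealI[OF ideal_splitting_prime is_cring])
  let ?P = "splitting_prime p R \<mm>"
  show "carrier R \<noteq> ?P" using assms by simp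
  fix a b assume a: "a \<in> carrier R" and b: "b \<in> carrier R" and ab: "a \<otimes> b \<in> ?P"
  show "a \<in> ?P \<or> b \<in> ?P"
  proof (rule ccontr)
    assume "\<not> (a \<in> ?P \<or> b \<in> ?P)"
    then obtain c d where c: "c \<ge> 1" "a \<notin> splitting_ideal p R \<mm> c"
      and d: "d \<ge> 1" "b \<notin> splitting_ideal p R \<mm> d"
      by (auto simp: splitting_prime_def)
    obtain \<phi> where \<phi>: "\<phi> \<in> fhoms c" "\<phi> a = \<one>" using notin_splitting_ideal[OF a c(2)] .
    obtain \<psi> where \<psi>: "\<psi> \<in> fhoms d" "\<psi> b = \<one>" using notin_splitting_ideal[OF b d(2)] .
    have hom: "(\<lambda>x. \<psi> (\<phi> x)) \<in> fhoms (c + d)"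
      unfolding fhoms_iff
    proof (intro conjI ballI)
      fix x y assume x: "x \<in> carrier R" and y: "y \<in> carrier R"
      note xy = fhoms_closed[OF \<phi>(1) x] fhoms_closed[OF \<phi>(1) y]
      show "\<psi> (\<phi> x) \<in> carrier R" using fhoms_closed[OF \<psi>(1) xy(1)] .
      show "\<psi> (\<phi> (x \<oplus> y)) = \<psi> (\<phi> x) \<oplus> \<psi> (\<phi> y)"
        using fhoms_add[OF \<psi>(1) xy] fhoms_add[OF \<phi>(1) x y] by simp
      have "\<phi> (frob (c + d) y \<otimes> x) = frob d y \<otimes> \<phi> x"
        using fhoms_smult[OF \<phi>(1) frob_closed[OF y] x, of d] y by simp
      then show "\<psi> (\<phi> (frob (c + d) y \<otimes> x)) = y \<otimes> \<psi> (\<phi> x)"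
        using fhoms_smult[OF \<psi>(1) y xy(1)] by simp
    qed
    obtain m where "p ^ c = Suc m" using p_gt_1 by (cases "p ^ c") auto
    then have "frob c b \<otimes> a = b [^] m \<otimes> (a \<otimes> b)"
      using a b by (simp add: frob_def m_ac)
    also have "\<dots> \<in> ?P" using ideal.I_l_closed[OF ideal_splitting_prime ab] b by simp
    finally have "frob c b \<otimes> a \<in> splitting_ideal p R \<mm> (c + d)" using splitting_prime_subset[of "c + d"] c by auto
    then have "\<psi> (\<phi> (frob c b \<otimes> a)) \<in> \<mm>" using hom by (auto simp: splitting_ideal_iff)
    moreover have "\<psi> (\<phi> (frob c b \<otimes> a)) = \<one>"
      using fhoms_smult[OF \<phi>(1) b a] \<phi>(2) \<psi>(2) b by simp
    ultimately show False using one_notin_mm by simp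
  qed
qed

section \<open>The rank of F_*D and the recursion for splitting numbers\<close>

lemma exists_max_indep:
  assumes P: "primeideal P R"
  obtains us where "indep_list (fcl 1 P P) us" "set us \<subseteq> carrier R" "carrier R \<subseteq> fcl 1 P P (set us)"
proof -
  obtain N where "fgen 1 {\<zero>} N" by (rule fgen_1)
  then have N: "fgen 1 P N"
    using fsub_zero[OF fsub_ideal[OF primeideal.axioms(1)[OF P]]]
    by (intro fgen_mono_base[OF _ _ fsub_ideal[OF primeideal.axioms(1)[OF P]]]) auto
  let ?Q = "\<lambda>us. indep_list (fcl 1 P P) us \<and> set us \<subseteq> carrier R"
  have "?Q []" by (simp add: indep_list.Nil)
  moreover have "\<forall>us. ?Q us \<longrightarrow> length us < Suc N"
    using indep_length_le[OF annihilates_prime[OF P] _ _ N] by (auto simp: less_Suc_eq_le)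
  ultimately obtain us where us: "?Q us" "\<And>vs. ?Q vs \<Longrightarrow> length vs \<le> length us"
    using ex_has_greatest_nat[of ?Q "[]" length "Suc N"] by auto
  have "r \<in> fcl 1 P P (set us)" if "r \<in> carrier R" for r
  proof (rule ccontr)
    assume "r \<notin> fcl 1 P P (set us)"
    then have "?Q (r # us)" using us(1) that by (simp add: indep_list_Cons_iff)
    from us(2)[OF this] show False by simp
  qed
  then show thesis using that us(1) by blast
qed

text \<open>Finitely many elements generate F_*R, so the product of their denominators serves for
  all of it.\<close>

lemma common_denominator:
  assumes P: "primeideal P R" and us: "set us \<subseteq> carrier R" "carrier R \<subseteq> fcl 1 P P (set us)"
  obtains c where "c \<in> carrier R" "c \<notin> P" "\<And>r. r \<in> carrier R \<Longrightarrow> frob 1 c \<otimes> r \<in> fspan 1 (set us) P"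
proof -
  let ?A = "fspan 1 (set us) P"
  note A = fsub_fspan[OF fsub_ideal[OF primeideal.axioms(1)[OF P]] us(1), of 1]
  obtain N where "fgen 1 {\<zero>} N" by (rule fgen_1)
  then obtain Z where Z: "finite Z" "Z \<subseteq> carrier R" "fspan 1 Z {\<zero>} = carrier R"
    unfolding fgen_def by blast
  have "\<exists>c\<in>carrier R - P. \<forall>z\<in>Z. frob 1 c \<otimes> z \<in> ?A"
    using Z(1,2)
  proof (induction Z rule: finite_induct)
    case empty
    then show ?case using prime_one_notin[OF P] by auto
  next
    case (insert z Z)
    then obtain c where c: "c \<in> carrier R - P" "\<And>z. z \<in> Z \<Longrightarrow> frob 1 c \<otimes> z \<in> ?A" by auto
    have z: "z \<in> carrier R" using insert.prems by simp
    then have "z \<in> fcl 1 P P (set us)" using us(2) by (rule rev_subsetD)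
    then obtain b where b: "b \<in> carrier R - P" "frob 1 b \<otimes> z \<in> ?A" by (auto simp: fcl_def)
    have eq: "frob 1 (b \<otimes> c) \<otimes> y = frob 1 b \<otimes> (frob 1 c \<otimes> y)"
      "frob 1 (b \<otimes> c) \<otimes> y = frob 1 c \<otimes> (frob 1 b \<otimes> y)" if "y \<in> carrier R" for y
      using b c that by (simp_all add: frob_mult m_ac del: One_nat_def)
    have "frob 1 (b \<otimes> c) \<otimes> z \<in> ?A"
      unfolding eq(2)[OF z] using fsub_smult[OF A _ b(2)] c(1) by blast
    moreover have "frob 1 (b \<otimes> c) \<otimes> y \<in> ?A" if "y \<in> Z" for y
    proof -
      have "y \<in> carrier R" using that insert.prems by blast
      then show ?thesis using eq(1) fsub_smult[OF A _ c(2)[OF that]] b(1) by simp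
    qed
    ultimately show ?case using prime_mult_notin[OF P b(1) c(1)] by blast
  qed
  then obtain c where c: "c \<in> carrier R" "c \<notin> P" "\<And>z. z \<in> Z \<Longrightarrow> frob 1 c \<otimes> z \<in> ?A" by auto
  let ?D = "{r \<in> carrier R. frob 1 c \<otimes> r \<in> ?A}"
  have "frob 1 c \<otimes> (frob 1 s \<otimes> x) = frob 1 s \<otimes> (frob 1 c \<otimes> x)"
    if "s \<in> carrier R" "x \<in> carrier R" for s x
    using c that by (simp add: m_ac)
  then have "fsub 1 ?D"
    using fsub_zero[OF A] fsub_add[OF A] fsub_smult[OF A] c(1)
    by (auto simp: fsub_def r_distr simp del: One_nat_def)
  then have "fspan 1 Z {\<zero>} \<subseteq> ?D"
    using c Z(2) fsub_zero[OF A] by (intro fspan_minimal) (auto simp del: One_nat_def)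
  then have "frob 1 c \<otimes> r \<in> ?A" if "r \<in> carrier R" for r using that unfolding Z(3) by blast
  then show thesis using that c by blast
qed

text \<open>\<open>F\<^bsup>e+1\<^esup>\<^sub>*(R/I\<^bsub>e+1\<^esub>)\<close> is generated by \<open>F\<^sub>*\<close> of generators of \<open>F\<^sup>e\<^sub>*(R/I\<^sub>e)\<close> times the \<open>us\<close>, up to
  the cokernel of the map given by the \<open>us\<close>, which is killed by \<open>c\<close>.\<close>

lemma splitting_number_step:
  assumes IP: "ideal P R" and Ps: "P \<subseteq> splitting_ideal p R \<mm> (Suc e)"
    and us: "set us \<subseteq> carrier R"
    and c: "c \<in> carrier R" "\<And>r. r \<in> carrier R \<Longrightarrow> frob 1 c \<otimes> r \<in> fspan 1 (set us) P"
    and N: "fgen 1 {\<zero>} N" and h: "fgen e (P <+>\<^bsub>R\<^esub> PIdl c) h"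
  shows "splitting_number p R (Suc e) \<le> length us * splitting_number p R e + N * h"
proof -
  let ?J = "P <+>\<^bsub>R\<^esub> PIdl c" and ?I = "splitting_ideal p R \<mm>" and ?A = "fspan 1 (set us) P"
  note A = fsub_fspan[OF fsub_ideal[OF IP] us, of 1]
  have J: "ideal ?J R" by (intro add_ideals IP cgenideal_ideal c)
  have A': "fsub (1 + e) ?A"
    unfolding fsub_def
  proof (intro conjI ballI)
    fix s x assume s: "s \<in> carrier R" and "x \<in> ?A"
    then show "frob (1 + e) s \<otimes> x \<in> ?A" using fsub_smult[OF A frob_closed[OF s, of e]] by simp
  qed (use A in \<open>auto simp: fsub_def\<close>)
  obtain Y where Y: "finite Y" "Y \<subseteq> carrier R" "card Y \<le> h" "fspan e Y ?J = carrier R"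
    using h unfolding fgen_def by blast
  obtain Z where Z: "finite Z" "Z \<subseteq> carrier R" "card Z \<le> N" "fspan 1 Z {\<zero>} = carrier R"
    using N unfolding fgen_def by blast
  let ?V = "(\<lambda>(y, z). frob 1 y \<otimes> z) ` (Y \<times> Z)"
  \<comment> \<open>The cokernel \<open>F_*R / ?A\<close> is generated by \<open>Z\<close> and
    killed by \<open>P\<close> and \<open>c\<close>, so coefficients count only modulo
    \<open>?J\<close>; this yields the error term.\<close>
  have "fspan 1 Z {\<zero>} \<subseteq> fspan (1 + e) ?V ?A"
  proof (rule fspan_pushforward[OF A' Y(2,4) fsub_ideal[OF J] Z(2)])
    show "{\<zero>} \<subseteq> ?A" using fsub_zero[OF A] by simp
    fix w z assume w: "w \<in> ?J" and "z \<in> Z"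
    then have z: "z \<in> carrier R" using Z(2) by blast
    obtain b u where b: "b \<in> P" and u: "u \<in> carrier R" and wb: "w = b \<oplus> u \<otimes> c"
      using w by (auto simp: set_add_def' cgenideal_def)
    have bc: "b \<in> carrier R" using ideal.Icarr[OF IP b] .
    have "frob 1 w \<otimes> z = frob 1 b \<otimes> z \<oplus> frob 1 u \<otimes> (frob 1 c \<otimes> z)"
      unfolding wb using bc u c(1) z by (simp add: frob_add frob_mult l_distr m_assoc)
    moreover have "frob 1 b \<otimes> z \<in> ?A"
      using ideal.I_r_closed[OF IP frob_mem_ideal[OF IP b] z] by (rule fspan.base)
    moreover have "frob 1 u \<otimes> (frob 1 c \<otimes> z) \<in> ?A" using fsub_smult[OF A u c(2)[OF z]] .
    ultimately show "frob 1 w \<otimes> z \<in> ?A" using fspan.add by simp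
  qed
  then have 1: "fgen (1 + e) ?A (h * N)"
    unfolding Z(4)
  proof (rule fgenI[OF A', rotated 3])
    show "finite ?V" "card ?V \<le> h * N" using Y Z by (auto intro!: card_products_le)
    show "?V \<subseteq> carrier R" using Y Z by (auto simp: subset_eq)
  qed
  obtain T where T: "finite T" "T \<subseteq> carrier R" "card T \<le> splitting_number p R e"
    "fspan e T (?I e) = carrier R"
    using fgen_splitting_number unfolding fgen_def by blast
  let ?W = "(\<lambda>(y, z). frob 1 y \<otimes> z) ` (T \<times> set us)"
  have I: "fsub (1 + e) (?I (1 + e))" by (rule fsub_ideal[OF ideal_splitting_ideal])
  \<comment> \<open>Modulo I_(e+1) the coefficients of the \<open>us\<close> count only modulo I_e,
    by \<open>frob_mem_splitting_ideal\<close>; this yields the main term.\<close>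
  have "?A \<subseteq> fspan (1 + e) ?W (?I (1 + e))"
  proof (rule fspan_pushforward[OF I T(2,4) fsub_ideal[OF ideal_splitting_ideal] us])
    show "P \<subseteq> ?I (1 + e)" using Ps by simp
    fix w z assume "w \<in> ?I e" "z \<in> set us"
    then show "frob 1 w \<otimes> z \<in> ?I (1 + e)"
      using us ideal.I_r_closed[OF ideal_splitting_ideal frob_mem_splitting_ideal] by blast
  qed
  moreover have "finite ?W" "?W \<subseteq> carrier R" using T us by (auto simp: subset_eq)
  ultimately have "fgen (1 + e) (?I (1 + e)) (h * N + card ?W)"
    by (intro fgen_trans[OF A' I 1])
  then have "splitting_number p R (1 + e) \<le> h * N + card ?W" by (rule splitting_number_le)
  also have "card ?W \<le> splitting_number p R e * length us"
    using T by (intro card_products_le) (auto simp: card_length)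
  finally show ?thesis by (simp add: mult.commute)
qed

end

section \<open>Dimension of quotients and the residue field\<close>

lemma carrier_FactRing: "carrier (R Quot P) = (\<lambda>r. P +>\<^bsub>R\<^esub> r) ` carrier R"
  by (auto simp: FactRing_def A_RCOSETS_def')

text \<open>Because \<open>P \<subseteq> J\<close>, the ideal \<open>J\<close> is a union of cosets
  of \<open>P\<close>.\<close>

lemma (in ring) rcos_mem_image_iff:
  assumes "ideal P R" "ideal J R" "P \<subseteq> J" "r \<in> carrier R"
  shows "P +> r \<in> (+>) P ` J \<longleftrightarrow> r \<in> J"
proof
  interpret P: ideal P R by fact
  assume "P +> r \<in> (+>) P ` J"
  then obtain j where j: "j \<in> J" "P +> r = P +> j" by auto
  have "r \<in> P +> j" using P.a_rcos_self[OF assms(4)] j(2) by simp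
  then obtain q where q: "q \<in> P" "r = q \<oplus> j" by (auto simp: a_r_coset_def')
  have "q \<in> J" using q(1) assms(3) by blast
  then show "r \<in> J"
    unfolding q(2) using j(1) by (rule additive_subgroup.a_closed[OF ideal.axioms(1)[OF assms(2)]])
qed simp

lemma (in cring) primeideal_image_rcos:
  assumes P: "ideal P R" and J: "primeideal J R" and PJ: "P \<subseteq> J"
  shows "primeideal ((+>) P ` J) (R Quot P)"
proof (rule primeidealI)
  note IJ = primeideal.axioms(1)[OF J]
  interpret h: ring_hom_ring R "R Quot P" "(+>) P" by (rule ideal.rcos_ring_hom_ring[OF P])
  note carr = carrier_FactRing[of R P]
  show "ideal ((+>) P ` J) (R Quot P)" by (rule ring_ideal_imp_quot_ideal[OF P IJ])
  show "cring (R Quot P)" by (rule ideal.quotient_is_cring[OF P is_cring])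
  show "carrier (R Quot P) \<noteq> (+>) P ` J"
  proof
    assume "carrier (R Quot P) = (+>) P ` J"
    then have "P +> \<one> \<in> (+>) P ` J" using carr by blast
    then have "\<one> \<in> J" by (rule iffD1[OF rcos_mem_image_iff[OF P IJ PJ one_closed]])
    then show False
      using ideal.one_imp_carrier[OF IJ] primeideal.I_notcarr[OF J] by simp
  qed
  fix x y assume "x \<in> carrier (R Quot P)" "y \<in> carrier (R Quot P)"
    and xy: "x \<otimes>\<^bsub>R Quot P\<^esub> y \<in> (+>) P ` J"
  then obtain a b where a: "a \<in> carrier R" "x = P +> a" and b: "b \<in> carrier R" "y = P +> b"
    by (auto simp: carr)
  have "P +> (a \<otimes> b) \<in> (+>) P ` J" using xy a b by simp
  then have "a \<otimes> b \<in> J"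
    by (rule iffD1[OF rcos_mem_image_iff[OF P IJ PJ m_closed[OF a(1) b(1)]]])
  then have "a \<in> J \<or> b \<in> J" by (rule primeideal.I_prime[OF J a(1) b(1)])
  then show "x \<in> (+>) P ` J \<or> y \<in> (+>) P ` J" using a b by auto
qed

text \<open>Prime chains are pulled back along the surjection onto the quotient. For the splitting
  prime this also gives finiteness, hence the meaning of \<open>the_enat\<close> in the
  theorem.\<close>

lemma (in cring) krull_dim_quot_le:
  assumes P: "ideal P R"
  shows "krull_dim (R Quot P) \<le> krull_dim R"
  unfolding krull_dim_def
proof (rule SUP_subset_mono)
  interpret h: ring_hom_ring R "R Quot P" "(+>) P" by (rule ideal.rcos_ring_hom_ring[OF P])
  note carr = carrier_FactRing[of R P]
  show "{n. \<exists>f. (\<forall>i\<le>n. primeideal (f i) (R Quot P)) \<and> (\<forall>i<n. f i \<subset> f (Suc i))}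
    \<subseteq> {n. \<exists>f. (\<forall>i\<le>n. primeideal (f i) R) \<and> (\<forall>i<n. f i \<subset> f (Suc i))}"
  proof clarify
    fix n f
    assume f: "\<forall>i\<le>n. primeideal (f i) (R Quot P)" and chain: "\<forall>i<n. f i \<subset> f (Suc i)"
    let ?g = "\<lambda>i. {r \<in> carrier R. P +> r \<in> f i}"
    have "?g i \<subset> ?g (Suc i)" if i: "i < n" for i
    proof -
      have "f (Suc i) \<subseteq> carrier (R Quot P)"
        using f i ideal.Icarr[OF primeideal.axioms(1)] by (meson Suc_leI subsetI)
      moreover obtain x where "x \<in> f (Suc i)" "x \<notin> f i" using chain i by blast
      ultimately obtain r where "r \<in> carrier R" "P +> r \<in> f (Suc i)" "P +> r \<notin> f i"
        unfolding carr by blast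
      then show ?thesis using chain i by blast
    qed
    moreover have "primeideal (?g i) R" if "i \<le> n" for i
      using h.primeideal_vimage[OF is_cring] f that by blast
    ultimately show "\<exists>g. (\<forall>i\<le>n. primeideal (g i) R) \<and> (\<forall>i<n. g i \<subset> g (Suc i))"
      by (intro exI[of _ ?g]) auto
  qed
qed simp

text \<open>Primes above \<open>P\<close> have prime images, and strict inclusions stay strict. The
  \<open>Suc\<close> turns a dimension into a number of primes.\<close>

lemma (in noetherian_local_ring) prime_chains_le_krull_dim:
  assumes P: "ideal P R" and dim: "krull_dim (R Quot P) = enat \<delta>"
  shows "prime_chains_le P (Suc \<delta>)"
  unfolding prime_chains_le_def
proof (intro allI impI)
  fix m f
  assume f: "(\<forall>i\<le>m. primeideal (f i) R \<and> P \<subseteq> f i) \<and> (\<forall>i<m. f i \<subset> f (Suc i))"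
  have "(+>) P ` f i \<subset> (+>) P ` f (Suc i)" if im: "i < m" for i
  proof -
    obtain r where r: "r \<in> f (Suc i)" "r \<notin> f i" using f im by blast
    have i: "primeideal (f i) R" "P \<subseteq> f i" and si: "primeideal (f (Suc i)) R" using f im by auto
    have "r \<in> carrier R" using ideal.Icarr[OF primeideal.axioms(1)[OF si] r(1)] .
    then have "P +> r \<notin> (+>) P ` f i"
      using rcos_mem_image_iff[OF P primeideal.axioms(1)[OF i(1)] i(2)] r(2) by simp
    then show ?thesis using f im r(1) by blast
  qed
  moreover have "primeideal ((+>) P ` f i) (R Quot P)" if "i \<le> m" for i
    using f that by (intro primeideal_image_rcos[OF P]) auto
  ultimately have "enat m \<le> krull_dim (R Quot P)"
    unfolding krull_dim_def
    by (intro SUP_upper CollectI exI[of _ "\<lambda>i. (+>) P ` f i"] conjI allI impI)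
  then show "m < Suc \<delta>" using dim by simp
qed

section \<open>The degree of the residue field over its p-th powers\<close>

context F_finite_local_ring
begin

lemma residue_degree:
  obtains \<kappa> where "\<kappa> > 0" "fgen 1 \<mm> \<kappa>" "residue_alpha p R \<mm> = log (real p) (real \<kappa>)"
proof -
  define k where "k = R Quot \<mm>"
  interpret k: field k unfolding k_def by (rule quotient_is_field[OF is_cring])
  interpret h: ring_hom_ring R k "(+>) \<mm>" unfolding k_def by (rule rcos_ring_hom_ring)
  have carr: "carrier k = (+>) \<mm> ` carrier R"
    unfolding k_def by (rule carrier_FactRing)
  have h_eq: "r \<ominus> s \<in> \<mm>" if "r \<in> carrier R" "s \<in> carrier R" "\<mm> +> r = \<mm> +> s" for r s
    using that(3) quotient_eq_iff_same_a_r_cos[OF is_ideal that(1,2)] by (simp only:)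
  have h_mem: "\<mm> +> r = \<zero>\<^bsub>k\<^esub>" if "r \<in> \<mm>" for r
  proof -
    have "\<zero>\<^bsub>k\<^esub> = \<mm>" unfolding k_def FactRing_def by (simp only: ring.simps)
    then show ?thesis using a_rcos_const[OF that] by (simp only:)
  qed
  let ?F = "\<lambda>x. x [^]\<^bsub>k\<^esub> p"
  define K where "K = ?F ` carrier k"
  have hp: "(\<mm> +> r) [^]\<^bsub>k\<^esub> p = \<mm> +> frob 1 r" if "r \<in> carrier R" for r
    using h.hom_nat_pow[OF that, of p] by (simp add: frob_def)
  \<comment> \<open>Additivity of the Frobenius of \<open>k\<close> is inherited from
    \<open>frob 1\<close> on R; its image \<open>K\<close> is then a subfield.\<close>
  have "ring_hom_ring k k ?F"
  proof (rule ring_hom_ringI2[OF k.ring_axioms k.ring_axioms], rule ring_hom_memI)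
    fix x y assume "x \<in> carrier k" "y \<in> carrier k"
    then obtain a b where a: "a \<in> carrier R" "x = \<mm> +> a" and b: "b \<in> carrier R" "y = \<mm> +> b"
      by (auto simp: carr)
    have "x \<oplus>\<^bsub>k\<^esub> y = \<mm> +> (a \<oplus> b)" using a b by simp
    then show "?F (x \<oplus>\<^bsub>k\<^esub> y) = ?F x \<oplus>\<^bsub>k\<^esub> ?F y"
      using a b hp[of "a \<oplus> b"] hp[of a] hp[of b] by (simp add: frob_add)
    show "?F (x \<otimes>\<^bsub>k\<^esub> y) = ?F x \<otimes>\<^bsub>k\<^esub> ?F y"
      using \<open>x \<in> carrier k\<close> \<open>y \<in> carrier k\<close> by (rule k.nat_pow_distrib)
  qed auto
  then have sub: "subfield K k"
    unfolding K_def
    by (rule ring_hom_ring.img_is_subfield(2)[OF _ k.carrier_is_subfield k.one_not_zero])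
  have K: "\<mm> +> frob 1 r \<in> K" if "r \<in> carrier R" for r
    using hp[OF that] that unfolding K_def carr by blast
  have Span_closed: "k.Span K us \<subseteq> carrier k" if "set us \<subseteq> carrier k" for us
    using k.Span_in_carrier[OF subfieldE(3)[OF sub] that] .
  \<comment> \<open>Relations over \<open>K\<close> lift to R: a coefficient is the coset of some
    \<open>frob 1 s\<close>, and the discrepancy lies in \<open>\<mm>\<close>, the base of the
    span.\<close>
  have lift: "r \<in> fspan 1 (set us) \<mm>"
    if "set us \<subseteq> carrier R" "r \<in> carrier R" "\<mm> +> r \<in> k.Span K (map ((+>) \<mm>) us)" for us r
    using that
  proof (induction us arbitrary: r rule: list.induct)
    case Nil
    then have "\<mm> +> r = \<mm> +> \<zero>" using h_mem[of \<zero>] by simp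
    then have "r \<in> \<mm>" using h_eq[of r \<zero>] Nil by (simp add: a_minus_def)
    then show ?case by (rule fspan.base)
  next
    case (Cons u us)
    have u: "u \<in> carrier R" and us: "set us \<subseteq> carrier R" using Cons.prems by auto
    obtain x v where x: "x \<in> K" and v: "v \<in> k.Span K (map ((+>) \<mm>) us)"
      and eq: "\<mm> +> r = x \<otimes>\<^bsub>k\<^esub> (\<mm> +> u) \<oplus>\<^bsub>k\<^esub> v"
      using Cons.prems(3) by (auto simp: k.line_extension_mem_iff)
    obtain s where s: "s \<in> carrier R" "x = \<mm> +> frob 1 s"
      using x hp unfolding K_def carr by auto
    have "set (map ((+>) \<mm>) us) \<subseteq> carrier k" using us unfolding carr by auto
    then have "v \<in> carrier k" using v Span_closed by blast
    then obtain t where t: "t \<in> carrier R" "v = \<mm> +> t" unfolding carr by auto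
    have t': "t \<in> fspan 1 (set us) \<mm>" using Cons.IH[OF us t(1)] v t(2) by simp
    have "\<mm> +> r = \<mm> +> (frob 1 s \<otimes> u \<oplus> t)" unfolding eq s(2) t(2) using s u t by simp
    then have m: "r \<ominus> (frob 1 s \<otimes> u \<oplus> t) \<in> \<mm>" using h_eq Cons.prems(2) s u t by simp
    have eq': "(w \<oplus> (r \<ominus> w)) = r" if "w \<in> carrier R" for w
      using Cons.prems(2) that by (simp add: a_minus_def a_lcomm r_neg)
    have "t \<in> fspan 1 (set (u # us)) \<mm>"
      using t' fspan_mono[of "set us" "set (u # us)" \<mm> \<mm> 1] by auto
    moreover have "frob 1 s \<otimes> u \<in> fspan 1 (set (u # us)) \<mm>" using s by (intro fspan.gen) auto
    ultimately have "(frob 1 s \<otimes> u \<oplus> t) \<oplus> (r \<ominus> (frob 1 s \<otimes> u \<oplus> t)) \<in> fspan 1 (set (u # us)) \<mm>"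
      by (intro fspan.add fspan.base[OF m])
    then show ?case using eq'[of "frob 1 s \<otimes> u \<oplus> t"] s u t by simp
  qed
  \<comment> \<open>Generators of F_*R reduce to a finite spanning set of \<open>k\<close> over
    \<open>K\<close>, so that \<open>k.dim\<close> is the actual degree.\<close>
  have "k.finite_dimension K (carrier k)"
  proof -
    obtain N where "fgen 1 {\<zero>} N" by (rule fgen_1)
    then obtain A where A: "finite A" "A \<subseteq> carrier R" "fspan 1 A {\<zero>} = carrier R"
      unfolding fgen_def by blast
    obtain us where us: "set us = A" using finite_list[OF A(1)] by blast
    let ?us = "map ((+>) \<mm>) us"
    have usc: "set ?us \<subseteq> carrier k" using us A(2) unfolding carr by auto
    have "\<mm> +> r \<in> k.Span K ?us" if "r \<in> fspan 1 A {\<zero>}" for r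
      using that
    proof induction
      case (base b)
      then show ?case using k.Span_subgroup_props(2)[OF sub usc] by simp
    next
      case (gen s x)
      then have x: "x \<in> carrier R" using A(2) by blast
      have "\<mm> +> x \<in> k.Span K ?us" using k.Span_base_incl[OF sub usc] gen us by auto
      then show ?case using k.Span_smult_closed[OF sub usc K[OF gen(1)]] gen(1) x by simp
    next
      case (add a b)
      then show ?case using k.Span_subgroup_props(3)[OF sub usc] A by simp
    qed
    then have "carrier k \<subseteq> k.Span K ?us" unfolding A(3) carr by blast
    then have "k.Span K ?us = carrier k" using Span_closed[OF usc] by blast
    then show ?thesis using k.Span_finite_dimension[OF sub usc] by simp
  qed
  then have dim: "k.dimension (k.dim K (carrier k)) K (carrier k)"
    using k.finite_dimensionE[OF sub] by (simp add: over_def)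
  then obtain vs where vs: "set vs \<subseteq> carrier k" "length vs = k.dim K (carrier k)"
    "k.Span K vs = carrier k"
    using k.exists_base[OF sub dim] by auto
  have "\<exists>us. set us \<subseteq> carrier R \<and> map ((+>) \<mm>) us = vs"
    using vs(1) unfolding carr
  proof (induction vs)
    case (Cons v vs)
    then obtain us u where "set us \<subseteq> carrier R" "map ((+>) \<mm>) us = vs" "u \<in> carrier R" "v = \<mm> +> u"
      by auto
    then show ?case by (intro exI[of _ "u # us"]) simp
  qed simp
  then obtain us where us: "set us \<subseteq> carrier R" "map ((+>) \<mm>) us = vs" by blast
  have "carrier R \<subseteq> fspan 1 (set us) \<mm>"
    using lift[OF us(1)] unfolding us(2) vs(3) carr by blast
  moreover have "card (set us) \<le> k.dim K (carrier k)"
    using card_length[of us] vs(2) unfolding us(2)[symmetric] by simp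
  ultimately have fg: "fgen 1 \<mm> (k.dim K (carrier k))"
    using us(1) by (intro fgenI[OF fsub_ideal[OF is_ideal]]) auto
  have "k.dim K (carrier k) \<noteq> 0"
  proof
    assume "k.dim K (carrier k) = 0"
    then have "carrier k = {\<zero>\<^bsub>k\<^esub>}" using dim k.dimension_zero[OF sub] by simp
    then show False using k.one_closed k.one_not_zero by auto
  qed
  moreover have "residue_alpha p R \<mm> = log (real p) (real (k.dim K (carrier k)))"
    by (simp add: residue_alpha_def Let_def K_def k_def)
  ultimately show thesis using that fg by blast
qed

lemma splitting_prime_trivial:
  assumes "splitting_prime p R \<mm> = carrier R" "e \<ge> 1"
  shows "splitting_number p R e = 0"
proof -
  have "splitting_ideal p R \<mm> e = carrier R"
    using splitting_prime_subset[OF assms(2)] assms(1) ideal.Icarr[OF ideal_splitting_ideal] by blast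
  then have "fgen e (splitting_ideal p R \<mm> e) 0" by simp
  from splitting_number_le[OF this] show ?thesis by simp
qed

end

section \<open>Convergence\<close>

lemma convergent_of_ratio_bound:
  fixes b :: "nat \<Rightarrow> real"
  assumes nonneg: "\<And>e. b e \<ge> 0" and step: "\<And>e. b (Suc e) \<le> b e + K * q ^ e"
    and q: "0 \<le> q" "q \<le> 1 / 2" and K: "K \<ge> 0"
  shows "convergent b"
proof -
  \<comment> \<open>The correction absorbs the errors: for \<open>q \<le> 1 / 2\<close> it falls by
    at least \<open>K * q ^ e\<close> at each step, so the corrected sequence decreases.\<close>
  let ?c = "\<lambda>e. b e + 2 * K * q ^ e"
  have "?c (Suc e) \<le> ?c e" for e
  proof -
    have "2 * K * q ^ Suc e = q * (2 * K * q ^ e)" by simp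
    also have "\<dots> \<le> 1 / 2 * (2 * K * q ^ e)" using q K by (intro mult_right_mono) auto
    finally have "2 * K * q ^ Suc e \<le> K * q ^ e" by simp
    then show ?thesis using step[of e] by simp
  qed
  then have "decseq ?c" by (rule decseq_SucI)
  moreover have "0 \<le> ?c e" for e using nonneg q K by simp
  ultimately obtain l where l: "?c \<longlonglongrightarrow> l" using decseq_convergent by blast
  have "(\<lambda>e. 2 * K * q ^ e) \<longlonglongrightarrow> 2 * K * 0"
    using q by (intro tendsto_intros LIMSEQ_realpow_zero) auto
  then have "(\<lambda>e. ?c e - 2 * K * q ^ e) \<longlonglongrightarrow> l - 2 * K * 0" by (intro tendsto_diff l)
  then show ?thesis by (auto simp: convergent_def)
qed

text \<open>Comparing growth rates removes the constant: powers of a ratio above 1 would exceed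
  every \<open>C\<close>.\<close>

lemma power_bound_imp_le:
  fixes n L :: nat
  assumes "\<And>e. n ^ e \<le> C * L ^ e" "L > 0"
  shows "n \<le> L"
proof (rule ccontr)
  assume "\<not> n \<le> L"
  then have "1 < real n / real L" using assms(2) by simp
  then obtain e where "real C < (real n / real L) ^ e" using real_arch_pow by blast
  then have "real C * real L ^ e < real n ^ e" using assms(2) by (simp add: power_divide field_simps)
  then have "real (C * L ^ e) < real (n ^ e)" by simp
  then show False using assms(1)[of e] by linarith
qed

section \<open>Existence of the splitting ratio\<close>

context F_finite_local_ring
begin

lemma splitting_ratio_convergent:
  assumes P: "primeideal (splitting_prime p R \<mm>) R"
    and chains: "prime_chains_le (splitting_prime p R \<mm>) (Suc \<delta>)"
    and \<kappa>: "\<kappa> > 0" "fgen 1 \<mm> \<kappa>"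
  shows "convergent (\<lambda>e. real (splitting_number p R e) / real (\<kappa> * p ^ \<delta>) ^ e)"
proof -
  let ?P = "splitting_prime p R \<mm>" and ?L = "\<kappa> * p ^ \<delta>" and ?a = "splitting_number p R"
  note IP = primeideal.axioms(1)[OF P]
  have L: "?L > 0" using \<kappa> p_gt_1 by simp
  obtain us where us: "indep_list (fcl 1 ?P ?P) us" "set us \<subseteq> carrier R"
    "carrier R \<subseteq> fcl 1 ?P ?P (set us)"
    using exists_max_indep[OF P] .
  obtain c where c: "c \<in> carrier R" "c \<notin> ?P"
    "\<And>r. r \<in> carrier R \<Longrightarrow> frob 1 c \<otimes> r \<in> fspan 1 (set us) ?P"
    using common_denominator[OF P us(2,3)] by blast
  obtain N where N: "fgen 1 {\<zero>} N" by (rule fgen_1)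
  have n: "length us \<le> ?L"
  proof -
    obtain C where C: "\<forall>e. \<exists>h. fgen e ?P h \<and> h * p ^ e \<le> C * (\<kappa> * p ^ Suc \<delta>) ^ e"
      using dimension_bound[OF \<kappa>(2) IP chains] ..
    have "length us ^ e \<le> C * ?L ^ e" for e
    proof -
      obtain h where h: "fgen e ?P h" "h * p ^ e \<le> C * (\<kappa> * p ^ Suc \<delta>) ^ e"
        using C[rule_format, of e] by (elim exE conjE)
      \<comment> \<open>The extra \<open>p ^ e\<close> is the shift built into
        \<open>dimension_bound\<close>; cancelling it leaves the base \<open>?L\<close>.\<close>
      have "(\<kappa> * p ^ Suc \<delta>) ^ e = ?L ^ e * p ^ e"
        by (simp add: power_mult_distrib mult_ac)
      then have "h * p ^ e \<le> C * ?L ^ e * p ^ e" using h(2) by (simp only: mult.assoc)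
      then have "h \<le> C * ?L ^ e" using p_gt_1 by simp
      moreover obtain ws where ws: "indep_list (fcl e ?P ?P) ws" "set ws \<subseteq> carrier R"
        "length ws = length us ^ e"
        using indep_power[OF P us(1,2)] by blast
      moreover have "length ws \<le> h"
        by (rule indep_length_le[OF annihilates_prime[OF P] ws(1,2) h(1)])
      ultimately show ?thesis by simp
    qed
    then show ?thesis using L by (rule power_bound_imp_le)
  qed
  let ?J = "?P <+>\<^bsub>R\<^esub> PIdl c"
  have J: "ideal ?J R" by (intro add_ideals IP cgenideal_ideal c)
  \<comment> \<open>With \<open>\<delta>\<close> in place of \<open>Suc \<delta>\<close>, the powers
    of \<open>?L\<close> bound \<open>h * p ^ e\<close> rather than \<open>h\<close>. This gain is
    the summable factor in the error.\<close>
  have "prime_chains_le ?J \<delta>"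
    by (rule prime_chains_le_add_principal[OF P chains c(2) ideal_add_principal[OF IP c(1)]])
  then obtain C where C: "\<forall>e. \<exists>h. fgen e ?J h \<and> h * p ^ e \<le> C * ?L ^ e"
    using dimension_bound[OF \<kappa>(2) J] by blast
  have step: "real (?a (Suc e)) \<le> real ?L * real (?a e) + real (N * C) * (real ?L ^ e * (1 / real p) ^ e)"
    for e
  proof -
    obtain h where h: "fgen e ?J h" "h * p ^ e \<le> C * ?L ^ e"
      using C[rule_format, of e] by (elim exE conjE)
    have "real h * real p ^ e \<le> real C * real ?L ^ e"
      using h(2) by (metis of_nat_le_iff of_nat_mult of_nat_power)
    then have hb: "real h \<le> real C * (real ?L ^ e * (1 / real p) ^ e)"
      using p_gt_1 by (simp add: power_divide field_simps)
    have "?a (Suc e) \<le> length us * ?a e + N * h"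
      using splitting_prime_subset[of "Suc e"]
      by (intro splitting_number_step[OF IP _ us(2) c(1,3) N h(1)]) auto
    also have "\<dots> \<le> ?L * ?a e + N * h" using n by (intro add_right_mono mult_right_mono) auto
    finally have "real (?a (Suc e)) \<le> real (?L * ?a e + N * h)" by (rule of_nat_mono)
    also have "\<dots> = real ?L * real (?a e) + real N * real h" by simp
    also have "\<dots> \<le> real ?L * real (?a e) + real N * (real C * (real ?L ^ e * (1 / real p) ^ e))"
      using hb by (intro add_left_mono mult_left_mono) auto
    finally show ?thesis by (simp add: mult_ac)
  qed
  show ?thesis
  \<comment> \<open>Dividing the recursion by \<open>?L ^ Suc e\<close> produces these constants;
    the ratio is at most 1/2 because \<open>p\<close> is at least 2.\<close>
  proof (rule convergent_of_ratio_bound[where K = "real (N * C) / real ?L" and q = "1 / real p"])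
    fix e
    have Lpos: "real ?L > 0" using L by simp
    have split: "(l * x + c * (l ^ e * t)) / l ^ Suc e = x / l ^ e + c / l * t"
      if "l > 0" for l x c t :: real
      using that by (simp add: field_simps)
    have "real (?a (Suc e)) / real ?L ^ Suc e
        \<le> (real ?L * real (?a e) + real (N * C) * (real ?L ^ e * (1 / real p) ^ e)) / real ?L ^ Suc e"
      using step[of e] Lpos by (intro divide_right_mono) auto
    also have "\<dots> = real (?a e) / real ?L ^ e + real (N * C) / real ?L * (1 / real p) ^ e"
      using Lpos by (rule split)
    finally show "real (?a (Suc e)) / real ?L ^ Suc e
        \<le> real (?a e) / real ?L ^ e + real (N * C) / real ?L * (1 / real p) ^ e" .
  qed (use p_gt_1 in \<open>auto simp: field_simps\<close>)
qed

end

theorem theorem4p9: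
  fixes R :: "('a, 'b) ring_scheme" and \<mm> :: "'a set" and p d :: nat
  assumes "noetherian_local_ring R \<mm>"
    and "Factorial_Ring.prime p" and "has_characteristic R p"
    and "F_finite p R"
    and "krull_dim R = enat d"
  shows "convergent (\<lambda>e. real (splitting_number p R e)
           / real p powr (real e * (real d + residue_alpha p R \<mm>)))
      \<and> (\<exists>r. (\<lambda>e. real (splitting_number p R e)
           / real p powr (real e *
               (real (the_enat (krull_dim (R Quot splitting_prime p R \<mm>))) + residue_alpha p R \<mm>)))
           \<longlonglongrightarrow> r
         \<and> (splitting_prime p R \<mm> = carrier R \<longrightarrow> r = 0))"
proof -
  interpret F_finite_local_ring R \<mm> p
    by (intro F_finite_local_ring.intro F_finite_local_ring_axioms.intro char_p_ring.intro
        char_p_ring_axioms.intro noetherian_local_ring.axioms(1)[OF assms(1)] assms)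
  let ?P = "splitting_prime p R \<mm>" and ?a = "splitting_number p R"
  obtain \<kappa> where \<kappa>: "\<kappa> > 0" "fgen 1 \<mm> \<kappa>" and log: "residue_alpha p R \<mm> = log (real p) (real \<kappa>)"
    by (rule residue_degree)
  have p: "real p > 1" using p_gt_1 by simp
  have powr: "real p powr (real e * (real n + residue_alpha p R \<mm>)) = real (\<kappa> * p ^ n) ^ e" for e n :: nat
  proof -
    have "real p powr (real n + residue_alpha p R \<mm>) = real (\<kappa> * p ^ n)"
      using p \<kappa>(1) by (simp add: log powr_add powr_realpow)
    then have "(real p powr (real n + residue_alpha p R \<mm>)) powr real e = real (\<kappa> * p ^ n) ^ e"
      using p \<kappa>(1) by (simp only: powr_realpow) (simp add: powr_realpow del: of_nat_mult of_nat_power)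
    then show ?thesis by (simp add: powr_powr mult.commute)
  qed
  show ?thesis
  proof (cases "?P = carrier R")
    case True
    \<comment> \<open>The terms vanish from \<open>e = 1\<close> on, whatever the denominators, so
      both limits are 0.\<close>
    have "(\<lambda>e. real (?a e) / g e) \<longlonglongrightarrow> 0" for g :: "nat \<Rightarrow> real"
    proof (rule tendsto_eventually, rule eventually_sequentiallyI[of 1])
      show "real (?a e) / g e = 0" if "1 \<le> e" for e
        using splitting_prime_trivial[OF True that] by simp
    qed
    then show ?thesis unfolding convergent_def by (intro conjI exI) (assumption | simp)+
  next
    case False
    have "krull_dim (R Quot ?P) \<le> enat d"
      using krull_dim_quot_le[OF ideal_splitting_prime] assms(5) by simp
    then obtain \<delta> where \<delta>: "krull_dim (R Quot ?P) = enat \<delta>" "\<delta> \<le> d"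
      by (cases "krull_dim (R Quot ?P)") auto
    have conv: "convergent (\<lambda>e. real (?a e) / real (\<kappa> * p ^ \<delta>) ^ e)"
      by (rule splitting_ratio_convergent[OF primeideal_splitting_prime[OF False]
          prime_chains_le_krull_dim[OF ideal_splitting_prime \<delta>(1)] \<kappa>])
    \<comment> \<open>This geometric sequence converts the denominator for \<open>\<delta>\<close>
      into the one for \<open>d\<close>; it is constant when the dimensions agree.\<close>
    have "convergent (\<lambda>e. (1 / real p ^ (d - \<delta>)) ^ e)"
    proof (cases "d = \<delta>")
      case False
      have "1 / x \<le> 1" if "x > 1" for x :: real using that by simp
      moreover have "real p ^ (d - \<delta>) > 1" using False \<delta>(2) p by (intro one_less_power) auto
      ultimately have "1 / real p ^ (d - \<delta>) \<le> 1" by blast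
      then show ?thesis by (intro convergent_realpow) simp_all
    qed (simp add: convergent_const)
    note convergent_mult[OF conv this]
    moreover have "real (?a e) / real (\<kappa> * p ^ \<delta>) ^ e * (1 / real p ^ (d - \<delta>)) ^ e
        = real (?a e) / real (\<kappa> * p ^ d) ^ e" for e
    proof -
      have "p ^ d = p ^ \<delta> * p ^ (d - \<delta>)" using \<delta>(2) by (simp flip: power_add)
      then show ?thesis by (simp add: power_divide power_mult_distrib)
    qed
    ultimately have "convergent (\<lambda>e. real (?a e) / real (\<kappa> * p ^ d) ^ e)" by simp
    with conv show ?thesis using False \<delta>(1) by (auto simp: powr convergent_def)
  qed
qed

end
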